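(* For every history-deterministic one-counter net $\mathcal{N}$ there exists a deterministic one-counter automaton $\mathcal{D}$ with $\mathcal{L}(\mathcal{D})=\mathcal{L}(\mathcal{N})$.
   Context: A one-counter net (OCN) is $\mathcal{N}=(Q,\Sigma,\Delta,q_0,F)$ with $Q$ finite, $\Sigma$ finite, $q_0\in Q$, $F\subseteq Q$, $\Delta\subseteq Q\times\Sigma\times\{-1,0,1\}\times Q$; configurations $(q,n)\in Q\times\mathbb{N}$, step $(q,n)\xrightarrow{a,d}(p,n+d)$ if $(q,a,d,p)\in\Delta$ and $n+d\ge0$; runs start at $(q_0,0)$ and are accepting if the last state is in $F$; $\mathcal{L}(\mathcal{N})$ is the set of words with an accepting run. Letter game: positions $(c,w)$, start $((q_0,0),\varepsilon)$; each round Adam picks $a\in\Sigma$, Eve picks a step $c\xrightarrow{a,d}c'$; if Eve has none and $wa$ is a prefix of a word of $\mathcal{L}(\mathcal{N})$ she loses; if $wa\in\mathcal{L}(\mathcal{N})$ but the state of $c'$ is not in $F$, Adam wins; otherwise continue from $(c',wa)$; Eve wins infinite plays. $\mathcal{N}$ is history-deterministic if Eve wins the letter game. A one-counter automaton (OCA) is $(Q,\Sigma,\Delta,q_0,F)$ with $\Delta\subseteq Q\times\{\mathrm{zero},\neg\mathrm{zero}\}\times\Sigma\times\{-1,0,1\}\times Q$, where $\mathrm{zero}$-transitions may be taken only when the counter is $0$ (with update in $\{0,1\}$) and $\neg\mathrm{zero}$-transitions only when it is positive; runs, acceptance and language as for OCNs. It is deterministic if $\Delta$ is a partial function from $Q\times\{\mathrm{zero},\neg\mathrm{zero}\}\times\Sigma$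 to $\{-1,0,1\}\times Q$. *)

theory Defs
  imports Main
begin

record ('q, 'a) ocn =
  ocn_states :: "'q set"
  ocn_alph   :: "'a set"
  ocn_delta  :: "('q \<times> 'a \<times> int \<times> 'q) set"
  ocn_init   :: 'q
  ocn_final  :: "'q set"

definition wf_ocn :: "('q, 'a) ocn \<Rightarrow> bool" where
  "wf_ocn N \<longleftrightarrow> finite (ocn_states N) \<and> finite (ocn_alph N) \<and>
     ocn_init N \<in> ocn_states N \<and> ocn_final N \<subseteq> ocn_states N \<and>
     ocn_delta N \<subseteq> ocn_states N \<times> ocn_alph N \<times> {-1, 0, 1} \<times> ocn_states N"

definition ocn_step :: "('q, 'a) ocn \<Rightarrow> 'q \<times> nat \<Rightarrow> 'a \<Rightarrow> 'q \<times> nat \<Rightarrow> bool" where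
  "ocn_step N c a c' \<longleftrightarrow> (\<exists>d. (fst c, a, d, fst c') \<in> ocn_delta N \<and>
       int (snd c) + d \<ge> 0 \<and> snd c' = nat (int (snd c) + d))"

inductive ocn_run :: "('q, 'a) ocn \<Rightarrow> 'q \<times> nat \<Rightarrow> 'a list \<Rightarrow> 'q \<times> nat \<Rightarrow> bool"
  for N where
  ocn_run_nil: "ocn_run N c [] c"
| ocn_run_cons: "ocn_step N c a c' \<Longrightarrow> ocn_run N c' w c'' \<Longrightarrow> ocn_run N c (a # w) c''"

definition ocn_lang :: "('q, 'a) ocn \<Rightarrow> 'a list set" where
  "ocn_lang N = {w. \<exists>c. ocn_run N (ocn_init N, 0) w c \<and> fst c \<in> ocn_final N}"

text \<open>A strategy for Eve maps the word read so far and Adam's new letter to a transition.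
  (Eve's own previous choices are determined by the strategy, so this is w.l.o.g.)
  Applying the chosen transition from the current configuration either yields a legal step
  or Eve is stuck (None).\<close>

type_synonym ('q, 'a) eve_strategy = "'a list \<Rightarrow> 'a \<Rightarrow> ('q \<times> 'a \<times> int \<times> 'q)"

definition apply_trans ::
  "('q, 'a) ocn \<Rightarrow> 'q \<times> nat \<Rightarrow> 'a \<Rightarrow> ('q \<times> 'a \<times> int \<times> 'q) \<Rightarrow> ('q \<times> nat) option" where
  "apply_trans N c a t =
     (case t of (q, b, d, p) \<Rightarrow>
        if t \<in> ocn_delta N \<and> q = fst c \<and> b = a \<and> int (snd c) + d \<ge> 0
        then Some (p, nat (int (snd c) + d)) else None)"

fun play_conf_rev :: "('q, 'a) ocn \<Rightarrow> ('q, 'a) eve_strategy \<Rightarrow> 'a list \<Rightarrow> ('q \<times> nat) option" where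
  "play_conf_rev N \<sigma> [] = Some (ocn_init N, 0)"
| "play_conf_rev N \<sigma> (a # rw) =
     (case play_conf_rev N \<sigma> rw of
        None \<Rightarrow> None
      | Some c \<Rightarrow> apply_trans N c a (\<sigma> (rev rw) a))"

definition play_conf :: "('q, 'a) ocn \<Rightarrow> ('q, 'a) eve_strategy \<Rightarrow> 'a list \<Rightarrow> ('q \<times> nat) option" where
  "play_conf N \<sigma> w = play_conf_rev N \<sigma> (rev w)"

text \<open>Eve's strategy is winning: whenever Adam's word w@[a] is a prefix of a word of the
  language, Eve has (by the strategy) made a legal step, and if w@[a] is in the language,
  the reached state is final. (Plays leaving the prefixes of the language can no longer be
  lost by Eve.)\<close>
definition winning_strategy :: "('q, 'a) ocn \<Rightarrow> ('q, 'a) eve_strategy \<Rightarrow> bool" where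
  "winning_strategy N \<sigma> \<longleftrightarrow>
     (\<forall>w a. a \<in> ocn_alph N \<and> (\<exists>v. (w @ [a]) @ v \<in> ocn_lang N) \<longrightarrow>
        (\<exists>c. play_conf N \<sigma> (w @ [a]) = Some c \<and>
             (w @ [a] \<in> ocn_lang N \<longrightarrow> fst c \<in> ocn_final N)))"

definition history_deterministic :: "('q, 'a) ocn \<Rightarrow> bool" where
  "history_deterministic N \<longleftrightarrow> (\<exists>\<sigma>. winning_strategy N \<sigma>)"

text \<open>Transitions (q, z, a, d, p): z = True means a zero-test, z = False a non-zero test.\<close>

record ('q, 'a) oca =
  oca_states :: "'q set"
  oca_alph   :: "'a set"
  oca_delta  :: "('q \<times> bool \<times> 'a \<times> int \<times> 'q) set"
  oca_init   :: 'q
  oca_final  :: "'q set"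

definition wf_oca :: "('q, 'a) oca \<Rightarrow> bool" where
  "wf_oca A \<longleftrightarrow> finite (oca_states A) \<and> finite (oca_alph A) \<and>
     oca_init A \<in> oca_states A \<and> oca_final A \<subseteq> oca_states A \<and>
     oca_delta A \<subseteq> oca_states A \<times> UNIV \<times> oca_alph A \<times> {-1, 0, 1} \<times> oca_states A \<and>
     (\<forall>q a d p. (q, True, a, d, p) \<in> oca_delta A \<longrightarrow> d \<in> {0, 1})"

definition oca_step :: "('q, 'a) oca \<Rightarrow> 'q \<times> nat \<Rightarrow> 'a \<Rightarrow> 'q \<times> nat \<Rightarrow> bool" where
  "oca_step A c a c' \<longleftrightarrow> (\<exists>d. (fst c, snd c = 0, a, d, fst c') \<in> oca_delta A \<and>
       int (snd c) + d \<ge> 0 \<and> snd c' = nat (int (snd c) + d))"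

inductive oca_run :: "('q, 'a) oca \<Rightarrow> 'q \<times> nat \<Rightarrow> 'a list \<Rightarrow> 'q \<times> nat \<Rightarrow> bool"
  for A where
  oca_run_nil: "oca_run A c [] c"
| oca_run_cons: "oca_step A c a c' \<Longrightarrow> oca_run A c' w c'' \<Longrightarrow> oca_run A c (a # w) c''"

definition oca_lang :: "('q, 'a) oca \<Rightarrow> 'a list set" where
  "oca_lang A = {w. \<exists>c. oca_run A (oca_init A, 0) w c \<and> fst c \<in> oca_final A}"

definition deterministic_oca :: "('q, 'a) oca \<Rightarrow> bool" where
  "deterministic_oca A \<longleftrightarrow>
     (\<forall>q z a d p d' p'. (q, z, a, d, p) \<in> oca_delta A \<and> (q, z, a, d', p') \<in> oca_delta A
        \<longrightarrow> d = d' \<and> p = p')"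

end

theory Submission
  imports Defs Complex_Main
begin

text \<open>
  If Eve wins the letter game, her configuration after a word simulates every configuration reachable
  by that word. Hence she may play positionally: in configuration \<open>(q, n)\<close> she takes any transition whose
  target simulates all sibling targets. This choice can be implemented by a deterministic one-counter
  automaton as soon as it is eventually periodic in \<open>n\<close>, and for that it suffices that for all states
  \<open>p'\<close>, \<open>p\<close> and every offset \<open>k\<close> the set of all \<open>m\<close> such that \<open>(p, m + k)\<close> simulates \<open>(p', m)\<close> is eventually periodic.

  For each pair of states let \<open>f m\<close> be the least counter value with which Eve wins the simulation game
  against Adam's value \<open>m\<close>. For a slope \<open>\<theta>\<close>, weigh a round in which Adam's counter changes by \<open>d\<close> and
  Eve's by \<open>e\<close> with \<open>e - \<theta> d\<close>. Determinacy of the resulting energy game splits the pairs into those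
  where Eve keeps the weight bounded from below, so that \<open>f m \<le> \<theta> m + C\<close>, and those where Adam makes it
  drop at a constant rate, so that \<open>f\<close> exceeds a line of larger slope once slopes below \<open>\<theta>\<close> are excluded.
  Peeling off the smallest asymptotic slope repeatedly shows that each \<open>f\<close> has slope less than 1, or
  slope greater than 1, or stays within a bounded distance of the diagonal. In the first two cases the
  diagonals are eventually constant; in the last one two columns agree by the pigeonhole principle, and a
  column determines everything to its right.
\<close>

section \<open>Potentials for energy games\<close>

text \<open>Certificate for Eve: from \<open>x\<close> in \<open>Y\<close> she keeps the accumulated
  weight at least \<open>p y - p x\<close> at every later state \<open>y\<close>, as long as the
  play stays in \<open>T\<close>. Leaving \<open>T\<close> counts as success for her, and so does a
  state where Adam has no option.\<close>

definition eve_pot :: "'x set \<Rightarrow> ('x \<Rightarrow> ('x \<times> 'g::linordered_ab_group_add) set set) \<Rightarrow> 'x set \<Rightarrow> ('x \<Rightarrow> 'g) \<Rightarrow> bool" where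
  "eve_pot T ops Y p \<longleftrightarrow> Y \<subseteq> T \<and>
     (\<forall>x\<in>Y. \<forall>A\<in>ops x. \<exists>(y, w)\<in>A. y \<notin> T \<or> (y \<in> Y \<and> p y \<le> p x + w))"

text \<open>Certificate for Adam: he confines the play to \<open>T\<close> while accumulated weight
  plus \<open>q\<close> strictly decreases. An empty option wins for him at once. With finitely many
  edges, strictness becomes a constant rate of decrease.\<close>

definition adam_pot :: "'x set \<Rightarrow> ('x \<Rightarrow> ('x \<times> 'g::linordered_ab_group_add) set set) \<Rightarrow> ('x \<Rightarrow> 'g) \<Rightarrow> bool" where
  "adam_pot T ops q \<longleftrightarrow> (\<forall>x\<in>T. \<exists>A\<in>ops x. \<forall>(y, w)\<in>A. y \<in> T \<and> w + q y < q x)"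

text \<open>Asking Eve only for some nonempty region keeps the alternative stable under merging
  options and edges; the full partition is recovered afterwards.\<close>

definition pot_alt :: "'x set \<Rightarrow> ('x \<Rightarrow> ('x \<times> 'g::linordered_ab_group_add) set set) \<Rightarrow> bool" where
  "pot_alt T ops \<longleftrightarrow> (\<exists>Y p. Y \<noteq> {} \<and> eve_pot T ops Y p) \<or> (\<exists>q. adam_pot T ops q)"

lemma eve_potD:
  assumes "eve_pot T ops Y p" "x \<in> Y" "A \<in> ops x"
  obtains y w where "(y, w) \<in> A" "y \<notin> T \<or> (y \<in> Y \<and> p y \<le> p x + w)"
  using assms unfolding eve_pot_def by fast

lemma pot_alt_cases:
  assumes "pot_alt T ops"
  obtains (eve) Y p where "Y \<noteq> {}" "eve_pot T ops Y p" | (adam) q where "adam_pot T ops q"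
  using assms unfolding pot_alt_def by (elim disjE exE conjE) simp_all

lemma pot_alt_eve: "Y \<noteq> {} \<Longrightarrow> eve_pot T ops Y p \<Longrightarrow> pot_alt T ops"
  unfolding pot_alt_def by (intro disjI1 exI conjI)

lemma pot_alt_adam: "adam_pot T ops q \<Longrightarrow> pot_alt T ops"
  unfolding pot_alt_def by (intro disjI2 exI)

lemma finite_dense_between:
  fixes b :: "'g::unbounded_dense_linorder"
  assumes "finite A" "\<And>a. a \<in> A \<Longrightarrow> b < a"
  shows "\<exists>c. b < c \<and> (\<forall>a\<in>A. c < a)"
proof (cases "A = {}")
  case True
  then show ?thesis using gt_ex by auto
next
  case False
  then obtain c where "b < c" "c < Min A" using assms dense[of b "Min A"] by auto
  then show ?thesis using assms(1) False by (auto simp: Min_gr_iff)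
qed

lemma finite_strict_lower:
  fixes A :: "'g::unbounded_dense_linorder set"
  assumes "finite A"
  shows "\<exists>c. \<forall>a\<in>A. c < a"
proof (cases "A = {}")
  case False
  then show ?thesis using assms lt_ex[of "Min A"] by (auto simp: Min_gr_iff)
qed simp

lemma adam_pot_mono:
  assumes "adam_pot T ops q" "\<And>x. x \<in> T \<Longrightarrow> ops x \<subseteq> ops' x"
  shows "adam_pot T ops' q"
  using assms unfolding adam_pot_def by (meson subsetD)

text \<open>Induction step over the options at one state. More options only help Adam, so his
  potential for either restricted game survives. If Eve has a region in both, then either one of
  them avoids \<open>x0\<close> and is unaffected, or both contain it and their potentials are
  merged.\<close>

lemma pot_alt_split_option:
  fixes ops :: "'x \<Rightarrow> ('x \<times> 'g::linordered_ab_group_add) set set"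
  assumes "pot_alt T (ops(x0 := O1))" "pot_alt T (ops(x0 := O2))"
  shows "pot_alt T (ops(x0 := O1 \<union> O2))"
proof -
  let ?G = "ops(x0 := O1 \<union> O2)"
  have eve: "eve_pot T ?G Y p" if "eve_pot T (ops(x0 := P)) Y p" "x0 \<notin> Y" for P Y p
  proof -
    have "A \<in> (ops(x0 := P)) x" if "x \<in> Y" "A \<in> ?G x" for x A using that \<open>x0 \<notin> Y\<close> by auto
    then show ?thesis using that(1) unfolding eve_pot_def by blast
  qed
  have "pot_alt T ?G"
    if e1: "eve_pot T (ops(x0 := O1)) Y1 p1" and e2: "eve_pot T (ops(x0 := O2)) Y2 p2"
      and x1: "x0 \<in> Y1" and x2: "x0 \<in> Y2" for Y1 p1 Y2 p2
  proof -
    txt \<open>Eve keeps a separate account for each of the two restricted games: while one is being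
      played, the other is paused at \<^term>\<open>x0\<close>.\<close>
    define p where "p y = (if y \<in> Y1 \<and> y \<in> Y2 then min (p1 y + p2 x0) (p2 y + p1 x0)
       else if y \<in> Y1 then p1 y + p2 x0 else p2 y + p1 x0)" for y
    have le1: "p y \<le> p1 y + p2 x0" if "y \<in> Y1" for y using that by (auto simp: p_def)
    have le2: "p y \<le> p2 y + p1 x0" if "y \<in> Y2" for y using that by (auto simp: p_def)
    have s1: "\<exists>(y, w)\<in>A. y \<notin> T \<or> (y \<in> Y1 \<union> Y2 \<and> p y \<le> p x + w)"
      if x: "x \<in> Y1" "p x = p1 x + p2 x0" and A: "A \<in> (ops(x0 := O1)) x" for x A
    proof -
      obtain y w where yw: "(y, w) \<in> A" "y \<notin> T \<or> (y \<in> Y1 \<and> p1 y \<le> p1 x + w)"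
        using eve_potD[OF e1 x(1) A] .
      have "p y \<le> p x + w" if "y \<in> Y1" "p1 y \<le> p1 x + w"
      proof -
        have "p y \<le> p1 y + p2 x0" using le1 that by blast
        also have "\<dots> \<le> p1 x + w + p2 x0" using that by (simp add: add_right_mono)
        finally show ?thesis using x by (simp add: algebra_simps)
      qed
      then show ?thesis using yw by blast
    qed
    have s2: "\<exists>(y, w)\<in>A. y \<notin> T \<or> (y \<in> Y1 \<union> Y2 \<and> p y \<le> p x + w)"
      if x: "x \<in> Y2" "p x = p2 x + p1 x0" and A: "A \<in> (ops(x0 := O2)) x" for x A
    proof -
      obtain y w where yw: "(y, w) \<in> A" "y \<notin> T \<or> (y \<in> Y2 \<and> p2 y \<le> p2 x + w)"
        using eve_potD[OF e2 x(1) A] .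
      have "p y \<le> p x + w" if "y \<in> Y2" "p2 y \<le> p2 x + w"
      proof -
        have "p y \<le> p2 y + p1 x0" using le2 that by blast
        also have "\<dots> \<le> p2 x + w + p1 x0" using that by (simp add: add_right_mono)
        finally show ?thesis using x by (simp add: algebra_simps)
      qed
      then show ?thesis using yw by blast
    qed
    have "eve_pot T ?G (Y1 \<union> Y2) p"
      unfolding eve_pot_def
    proof (intro conjI ballI)
      show "Y1 \<union> Y2 \<subseteq> T" using e1 e2 by (auto simp: eve_pot_def)
      fix x A assume x: "x \<in> Y1 \<union> Y2" and A: "A \<in> ?G x"
      show "\<exists>(y, w)\<in>A. y \<notin> T \<or> (y \<in> Y1 \<union> Y2 \<and> p y \<le> p x + w)"
      proof (cases "x = x0")
        case True
        have px: "p x = p1 x + p2 x0" "p x = p2 x + p1 x0"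
          using True x1 x2 by (auto simp: p_def add.commute)
        from A True consider "A \<in> O1" | "A \<in> O2" by auto
        then show ?thesis
        proof cases
          case 1
          show ?thesis by (rule s1) (use px True x1 1 in simp_all)
        next
          case 2
          show ?thesis by (rule s2) (use px True x2 2 in simp_all)
        qed
      next
        case False
        then have A': "A \<in> (ops(x0 := O1)) x" "A \<in> (ops(x0 := O2)) x" using A by auto
        have "(x \<in> Y1 \<and> p x = p1 x + p2 x0) \<or> (x \<in> Y2 \<and> p x = p2 x + p1 x0)"
          using x by (auto simp: p_def min_def)
        then show ?thesis using s1 s2 A' by blast
      qed
    qed
    then show ?thesis using x1 pot_alt_eve[of "Y1 \<union> Y2"] by auto
  qed
  note both = this
  show ?thesis
    using assms(1)
  proof (cases rule: pot_alt_cases)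
    case (adam q)
    show ?thesis by (rule pot_alt_adam, rule adam_pot_mono[OF adam]) auto
  next
    case eve1: (eve Y1 p1)
    show ?thesis
      using assms(2)
    proof (cases rule: pot_alt_cases)
      case (adam q)
      show ?thesis by (rule pot_alt_adam, rule adam_pot_mono[OF adam]) auto
    next
      case eve2: (eve Y2 p2)
      consider "x0 \<notin> Y1" | "x0 \<notin> Y2" | "x0 \<in> Y1" "x0 \<in> Y2" by blast
      then show ?thesis
      proof cases
        case 1
        from eve[OF eve1(2) this] show ?thesis by (rule pot_alt_eve[OF eve1(1)])
      next
        case 2
        from eve[OF eve2(2) this] show ?thesis by (rule pot_alt_eve[OF eve2(1)])
      next
        case 3
        from both[OF eve1(2) eve2(2) this] show ?thesis .
      qed
    qed
  qed
qed

text \<open>Dual induction step, over the edges of a single option. More edges only help Eve; if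
  Adam wins both restricted games, his two potentials are merged.\<close>

lemma pot_alt_split_edges:
  fixes ops :: "'x \<Rightarrow> ('x \<times> 'g::linordered_ab_group_add) set set"
  assumes "x0 \<in> T" "pot_alt T (ops(x0 := {A1}))" "pot_alt T (ops(x0 := {A2}))"
  shows "pot_alt T (ops(x0 := {A1 \<union> A2}))"
proof -
  let ?G = "ops(x0 := {A1 \<union> A2})"
  have mono: "eve_pot T ?G Y p" if e: "eve_pot T (ops(x0 := {P})) Y p" "P \<subseteq> A1 \<union> A2" for P Y p
    unfolding eve_pot_def
  proof (intro conjI ballI)
    show "Y \<subseteq> T" using e by (auto simp: eve_pot_def)
    fix x A assume x: "x \<in> Y" and A: "A \<in> ?G x"
    show "\<exists>(y, w)\<in>A. y \<notin> T \<or> (y \<in> Y \<and> p y \<le> p x + w)"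
    proof (cases "x = x0")
      case True
      obtain y w where "(y, w) \<in> P" "y \<notin> T \<or> (y \<in> Y \<and> p y \<le> p x + w)"
        using eve_potD[OF e(1) x, of P] True by auto
      then show ?thesis using A True e(2) by auto
    next
      case False
      then have "A \<in> (ops(x0 := {P})) x" using A by simp
      then show ?thesis using e(1) x unfolding eve_pot_def by blast
    qed
  qed
  have "\<exists>q. adam_pot T ?G q"
    if a1: "adam_pot T (ops(x0 := {A1})) q1" and a2: "adam_pot T (ops(x0 := {A2})) q2" for q1 q2
  proof -
    \<comment> \<open>Each potential is shifted by the other's value at \<open>x0\<close>, so that
      they agree there and the option \<open>A1 \<union> A2\<close> decreases. At any other state
      Adam takes the option from the game in which the minimum is attained.\<close>
    define q where "q y = min (q1 y + q2 x0) (q2 y + q1 x0)" for y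
    have l1: "w + q y < q1 x + q2 x0" if "w + q1 y < q1 x" for w x y
    proof -
      have "w + q y \<le> w + q1 y + q2 x0" by (simp add: q_def add.assoc)
      also have "\<dots> < q1 x + q2 x0" using that by simp
      finally show ?thesis .
    qed
    have l2: "w + q y < q2 x + q1 x0" if "w + q2 y < q2 x" for w x y
    proof -
      have "w + q y \<le> w + q2 y + q1 x0" by (simp add: q_def add.assoc)
      also have "\<dots> < q2 x + q1 x0" using that by simp
      finally show ?thesis .
    qed
    have "adam_pot T ?G q"
      unfolding adam_pot_def
    proof
      fix x assume x: "x \<in> T"
      show "\<exists>A\<in>?G x. \<forall>(y, w)\<in>A. y \<in> T \<and> w + q y < q x"
      proof (cases "x = x0")
        case True
        have q: "q x = q1 x + q2 x0" "q x = q2 x + q1 x0" using True by (auto simp: q_def add.commute)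
        have "\<forall>(y, w)\<in>A1. y \<in> T \<and> w + q1 y < q1 x" "\<forall>(y, w)\<in>A2. y \<in> T \<and> w + q2 y < q2 x"
          using a1[unfolded adam_pot_def, rule_format, OF assms(1)]
            a2[unfolded adam_pot_def, rule_format, OF assms(1)] True by auto
        then have "\<forall>(y, w)\<in>A1 \<union> A2. y \<in> T \<and> w + q y < q x"
          using l1[where x = x] l2[where x = x] q by (metis (no_types, lifting) Un_iff case_prodI2 case_prodD)
        then show ?thesis using True by auto
      next
        case False
        have "q x = q1 x + q2 x0 \<or> q x = q2 x + q1 x0" by (auto simp: q_def min_def)
        then show ?thesis
        proof
          assume q: "q x = q1 x + q2 x0"
          obtain A where "A \<in> ops x" "\<forall>(y, w)\<in>A. y \<in> T \<and> w + q1 y < q1 x"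
            using a1 x False unfolding adam_pot_def by auto
          then show ?thesis using l1[of _ _ x] q False by (intro bexI[of _ A]) auto
        next
          assume q: "q x = q2 x + q1 x0"
          obtain A where "A \<in> ops x" "\<forall>(y, w)\<in>A. y \<in> T \<and> w + q2 y < q2 x"
            using a2 x False unfolding adam_pot_def by auto
          then show ?thesis using l2[of _ _ x] q False by (intro bexI[of _ A]) auto
        qed
      qed
    qed
    then show ?thesis by blast
  qed
  note both = this
  show ?thesis
    using assms(2)
  proof (cases rule: pot_alt_cases)
    case (eve Y p)
    show ?thesis by (rule pot_alt_eve[OF eve(1) mono[OF eve(2)]]) simp
  next
    case adam1: (adam q1)
    show ?thesis
      using assms(3)
    proof (cases rule: pot_alt_cases)
      case (eve Y p)
      show ?thesis by (rule pot_alt_eve[OF eve(1) mono[OF eve(2)]]) simp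
    next
      case (adam q2)
      show ?thesis using both[OF adam1 adam] pot_alt_adam by auto
    qed
  qed
qed

text \<open>Adam wins at \<open>x0\<close> because some option there is empty or has only negative
  loops. Edges into \<open>x0\<close> are thus useless to Eve and are deleted together with
  \<open>x0\<close>.\<close>

lemma pot_alt_remove:
  fixes ops :: "'x \<Rightarrow> ('x \<times> 'g::{linordered_ab_group_add, unbounded_dense_linorder}) set set"
  assumes fin: "finite T" "\<And>x. x \<in> T \<Longrightarrow> finite (ops x)" "\<And>x A. x \<in> T \<Longrightarrow> A \<in> ops x \<Longrightarrow> finite A"
    and x0: "x0 \<in> T" "A0 \<in> ops x0" "\<And>y w. (y, w) \<in> A0 \<Longrightarrow> y = x0 \<and> w < 0"
    and alt: "pot_alt (T - {x0}) (\<lambda>x. (\<lambda>A. {(y, w)\<in>A. y \<noteq> x0}) ` ops x)"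
  shows "pot_alt T ops"
proof -
  let ?T = "T - {x0}" and ?ops = "\<lambda>x. (\<lambda>A. {(y, w)\<in>A. y \<noteq> x0}) ` ops x"
  have eveQ: "eve_pot T ops Y p" if e: "eve_pot ?T ?ops Y p" for Y p
    unfolding eve_pot_def
  proof (intro conjI ballI)
    show "Y \<subseteq> T" using e by (auto simp: eve_pot_def)
    fix x A assume x: "x \<in> Y" and A: "A \<in> ops x"
    obtain y w where "(y, w) \<in> {(y, w)\<in>A. y \<noteq> x0}" "y \<notin> ?T \<or> (y \<in> Y \<and> p y \<le> p x + w)"
      using eve_potD[OF e x] A by blast
    then show "\<exists>(y, w)\<in>A. y \<notin> T \<or> (y \<in> Y \<and> p y \<le> p x + w)" by auto
  qed
  have adamQ: "\<exists>q. adam_pot T ops q" if a: "adam_pot ?T ?ops q" for q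
  proof -
    \<comment> \<open>A value \<open>c\<close> at \<open>x0\<close> below all of these makes every
      edge from \<open>?T\<close> into \<open>x0\<close> strictly decreasing; the loops in
      \<open>A0\<close> decrease by themselves, their weights being negative.\<close>
    define D where "D = (\<Union>x\<in>?T. \<Union>A\<in>ops x. (\<lambda>(y, w). q x - w) ` A)"
    have "finite D" unfolding D_def using fin by auto
    then obtain c where "\<forall>d\<in>D. c < d" using finite_strict_lower by auto
    then have c: "\<And>d. d \<in> D \<Longrightarrow> c < d" by simp
    have "adam_pot T ops (q(x0 := c))"
      unfolding adam_pot_def
    proof
      fix x assume x: "x \<in> T"
      show "\<exists>A\<in>ops x. \<forall>(y, w)\<in>A. y \<in> T \<and> w + (q(x0 := c)) y < (q(x0 := c)) x"
      proof (cases "x = x0")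
        case True
        then show ?thesis using x0 by (intro bexI[of _ A0]) (auto simp: add_less_same_cancel2)
      next
        case False
        then have "\<exists>A\<in>?ops x. \<forall>(y, w)\<in>A. y \<in> ?T \<and> w + q y < q x"
          using a x unfolding adam_pot_def by simp
        then obtain A where A: "A \<in> ops x"
          and *: "\<forall>(y, w)\<in>{(y, w)\<in>A. y \<noteq> x0}. y \<in> ?T \<and> w + q y < q x"
          by (auto simp only: bex_simps)
        have "w + c < q x" if "(x0, w) \<in> A" for w
        proof -
          have "q x - w \<in> D" unfolding D_def using that A x False by force
          from c[OF this] show ?thesis by (simp add: algebra_simps)
        qed
        then have "\<forall>(y, w)\<in>A. y \<in> T \<and> w + (q(x0 := c)) y < (q(x0 := c)) x"
          using * False x0 by auto
        then show ?thesis using A by blast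
      qed
    qed
    then show ?thesis by blast
  qed
  show ?thesis
    using alt
  proof (cases rule: pot_alt_cases)
    case (eve Y p)
    then show ?thesis using pot_alt_eve[OF eve(1) eveQ[OF eve(2)]] by simp
  next
    case (adam q)
    then show ?thesis using adamQ pot_alt_adam by auto
  qed
qed

text \<open>The only move at \<open>x0\<close> is forced, so \<open>x0\<close> can be bypassed:
  edges into it are redirected to \<open>y0\<close> with \<open>w0\<close> added. Eve's potential
  extends to \<open>x0\<close> with equality. Adam's value at \<open>x0\<close> must lie strictly
  between \<open>w0 + q y0\<close> and every \<open>q x - w\<close>, which is where density of the
  order enters.\<close>

lemma pot_alt_contract:
  fixes ops :: "'x \<Rightarrow> ('x \<times> 'g::{linordered_ab_group_add, unbounded_dense_linorder}) set set"
  assumes fin: "finite T" "\<And>x. x \<in> T \<Longrightarrow> finite (ops x)" "\<And>x A. x \<in> T \<Longrightarrow> A \<in> ops x \<Longrightarrow> finite A"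
    and x0: "x0 \<in> T" "ops x0 = {{(y0, w0)}}" and y0: "y0 \<in> T" "y0 \<noteq> x0"
    and alt: "pot_alt (T - {x0})
      (\<lambda>x. (`) (\<lambda>(y, w). if y = x0 then (y0, w + w0) else (y, w)) ` ops x)"
  shows "pot_alt T ops"
proof -
  let ?r = "\<lambda>(y, w). if y = x0 then (y0, w + w0) else (y, w)"
  let ?T = "T - {x0}" and ?ops = "\<lambda>x. (`) ?r ` ops x"
  have eveQ: "\<exists>Y' p'. Y' \<noteq> {} \<and> eve_pot T ops Y' p'" if e: "eve_pot ?T ?ops Y p" "Y \<noteq> {}" for Y p
  proof -
    define Y' where "Y' = (if y0 \<in> Y then insert x0 Y else Y)"
    define p' where "p' = p(x0 := p y0 - w0)"
    have x0Y: "x0 \<notin> Y" and YT: "Y \<subseteq> T" using e unfolding eve_pot_def by auto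
    have "eve_pot T ops Y' p'"
      unfolding eve_pot_def
    proof (intro conjI ballI)
      show "Y' \<subseteq> T" using YT x0 by (auto simp: Y'_def)
      fix x A assume x: "x \<in> Y'" and A: "A \<in> ops x"
      show "\<exists>(y, w)\<in>A. y \<notin> T \<or> (y \<in> Y' \<and> p' y \<le> p' x + w)"
      proof (cases "x = x0")
        case True
        then have "y0 \<in> Y" "A = {(y0, w0)}" using x x0 x0Y A by (auto simp: Y'_def split: if_splits)
        then show ?thesis using True y0 by (auto simp: Y'_def p'_def)
      next
        case False
        then have xY: "x \<in> Y" using x by (auto simp: Y'_def split: if_splits)
        have "?r ` A \<in> ?ops x" using A by simp
        then obtain y w where yw: "(y, w) \<in> ?r ` A" "y \<notin> ?T \<or> (y \<in> Y \<and> p y \<le> p x + w)"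
          by (rule eve_potD[OF e(1) xY])
        then obtain y1 w1 where 1: "(y1, w1) \<in> A" "(y, w) = ?r (y1, w1)" by auto
        have "y1 \<notin> T \<or> (y1 \<in> Y' \<and> p' y1 \<le> p' x + w1)"
        proof (cases "y1 = x0")
          case True
          then have "y = y0" "w = w1 + w0" using 1 by auto
          then show ?thesis using yw y0 True False by (auto simp: Y'_def p'_def algebra_simps)
        next
          case False2: False
          then have "y = y1" "w = w1" using 1 by auto
          then show ?thesis using yw False2 False by (auto simp: Y'_def p'_def)
        qed
        then show ?thesis using 1(1) by blast
      qed
    qed
    moreover have "Y' \<noteq> {}" using e by (auto simp: Y'_def)
    ultimately show ?thesis by blast
  qed
  have adamQ: "\<exists>q. adam_pot T ops q" if a: "adam_pot ?T ?ops q" for q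
  proof -
    have "\<forall>x\<in>?T. \<exists>A\<in>ops x. \<forall>(y, w)\<in>?r ` A. y \<in> ?T \<and> w + q y < q x"
      using a unfolding adam_pot_def by (auto simp only: bex_simps image_iff)
    then obtain s where s: "\<And>x. x \<in> ?T \<Longrightarrow> s x \<in> ops x"
      "\<And>x y w. x \<in> ?T \<Longrightarrow> (y, w) \<in> ?r ` s x \<Longrightarrow> y \<in> ?T \<and> w + q y < q x"
      by (metis (no_types, lifting) case_prodD)
    define D where "D = (\<Union>x\<in>?T. (\<lambda>(y, w). q x - w) ` {(y, w)\<in>s x. y = x0})"
    have fs: "finite {(y, w)\<in>s x. y = x0}" if "x \<in> ?T" for x
      by (rule finite_subset[of _ "s x"]) (use fin(3)[OF _ s(1)[OF that]] that in auto)
    then have "finite D" unfolding D_def using fin(1) by simp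
    moreover have "w0 + q y0 < d" if dD: "d \<in> D" for d
    proof -
      obtain x w where xw: "x \<in> ?T" "(x0, w) \<in> s x" "d = q x - w" using dD unfolding D_def by auto
      then have "(y0, w + w0) \<in> ?r ` s x" by force
      with s(2) xw have "w + w0 + q y0 < q x" by blast
      then have "w0 + q y0 < q x - w" by (simp add: algebra_simps)
      then show ?thesis using xw(3) by simp
    qed
    ultimately obtain c where c: "w0 + q y0 < c" "\<And>d. d \<in> D \<Longrightarrow> c < d"
      using finite_dense_between[of D "w0 + q y0"] by blast
    have "adam_pot T ops (q(x0 := c))"
      unfolding adam_pot_def
    proof
      fix x assume x: "x \<in> T"
      show "\<exists>A\<in>ops x. \<forall>(y, w)\<in>A. y \<in> T \<and> w + (q(x0 := c)) y < (q(x0 := c)) x"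
      proof (cases "x = x0")
        case True
        then show ?thesis using x0 y0 c by auto
      next
        case False
        then have xT: "x \<in> ?T" using x by blast
        have "y \<in> T \<and> w + (q(x0 := c)) y < q x" if yw: "(y, w) \<in> s x" for y w
        proof (cases "y = x0")
          case True
          have "q x - w \<in> D" unfolding D_def using yw True xT by force
          from c(2)[OF this] show ?thesis using True x0 by (simp add: algebra_simps)
        next
          case False
          then have "(y, w) \<in> ?r ` s x" using yw by force
          then show ?thesis using s(2)[OF xT] False by auto
        qed
        then show ?thesis using s(1)[OF xT] False by (intro bexI[of _ "s x"]) auto
      qed
    qed
    then show ?thesis by blast
  qed
  show ?thesis
    using alt
  proof (cases rule: pot_alt_cases)
    case (eve Y p)
    then obtain Y' p' where "Y' \<noteq> {}" "eve_pot T ops Y' p'"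
      using eveQ[OF eve(2) eve(1)] by auto
    then show ?thesis by (rule pot_alt_eve)
  next
    case (adam q)
    then show ?thesis using adamQ pot_alt_adam by auto
  qed
qed

text \<open>Induction on the number of states. The two splitting lemmas reduce a chosen state
  \<open>x0\<close> to one option with at most one edge, and such a state can be decided, removed or
  contracted.\<close>

theorem potential_alternative:
  fixes ops :: "'x \<Rightarrow> ('x \<times> 'g::{linordered_ab_group_add, unbounded_dense_linorder}) set set"
  assumes "finite T" "\<And>x. x \<in> T \<Longrightarrow> finite (ops x)" "\<And>x A. x \<in> T \<Longrightarrow> A \<in> ops x \<Longrightarrow> finite A"
  shows "pot_alt T ops"
  using assms
proof (induction "card T" arbitrary: T ops rule: less_induct)
  case less
  show ?case
  proof (cases "T = {}")
    case True
    then show ?thesis unfolding pot_alt_def adam_pot_def by simp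
  next
    case False
    then obtain x0 where x0: "x0 \<in> T" by blast
    have card: "card (T - {x0}) < card T" using less.prems(1) x0 by (rule card_Diff1_less)
    let ?C = "\<lambda>O'. ops(x0 := O')"
    have remove: "pot_alt T (?C {A})" if neg: "\<And>y w. (y, w) \<in> A \<Longrightarrow> y = x0 \<and> w < 0" "finite A" for A
    proof (rule pot_alt_remove[of T _ x0 A])
      show "pot_alt (T - {x0}) (\<lambda>x. (\<lambda>A. {(y, w)\<in>A. y \<noteq> x0}) ` ?C {A} x)"
      proof (rule less.hyps[OF card])
        show "finite (T - {x0})" using less.prems(1) by simp
        show "finite ((\<lambda>A. {(y, w)\<in>A. y \<noteq> x0}) ` ?C {A} x)" if "x \<in> T - {x0}" for x
          using that less.prems(2) by simp
        show "finite A'" if A': "x \<in> T - {x0}" "A' \<in> (\<lambda>A. {(y, w)\<in>A. y \<noteq> x0}) ` ?C {A} x" for x A'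
        proof -
          obtain A1 where "A1 \<in> ops x" "A' \<subseteq> A1" using A' by auto
          then show ?thesis using less.prems(3)[of x A1] A'(1) finite_subset[of A' A1] by blast
        qed
      qed
      show "finite (?C {A} x)" if "x \<in> T" for x using less.prems(2)[OF that] by simp
      show "finite A'" if "x \<in> T" "A' \<in> ?C {A} x" for x A'
        using less.prems(3)[OF that(1)] that(2) \<open>finite A\<close> by (cases "x = x0") simp_all
      show "A \<in> ?C {A} x0" by simp
      show "y = x0 \<and> w < 0" if "(y, w) \<in> A" for y w using that(1) neg by simp
    qed (fact less.prems(1) x0)+
    have single: "pot_alt T (?C {{(y, w)}})" for y w
    proof -
      \<comment> \<open>An exit or a nonnegative loop makes \<open>{x0}\<close> a region for Eve; a
        negative loop lets \<open>x0\<close> be removed; an edge to another state lets it be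
        contracted.\<close>
      have "y \<notin> T \<or> (y = x0 \<and> 0 \<le> w) \<or> (y = x0 \<and> w < 0) \<or> (y \<in> T \<and> y \<noteq> x0)"
        using leI by blast
      then consider (1) "y \<notin> T" | (2) "y = x0" "0 \<le> w" | (3) "y = x0" "w < 0" | (4) "y \<in> T" "y \<noteq> x0"
        by (elim disjE conjE)
      then show ?thesis
      proof cases
        case 1
        then have "eve_pot T (?C {{(y, w)}}) {x0} (\<lambda>_. 0)" using x0 by (auto simp: eve_pot_def)
        then show ?thesis by (rule pot_alt_eve[rotated]) simp
      next
        case 2
        then have "eve_pot T (?C {{(y, w)}}) {x0} (\<lambda>_. 0)" using x0 by (auto simp: eve_pot_def)
        then show ?thesis by (rule pot_alt_eve[rotated]) simp
      next
        case 3
        then show ?thesis by (intro remove) auto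
      next
        case 4
        show ?thesis
        proof (rule pot_alt_contract[of T _ x0 y w])
          show "pot_alt (T - {x0}) (\<lambda>x. (`) (\<lambda>(y', w'). if y' = x0 then (y, w' + w) else (y', w')) ` ?C {{(y, w)}} x)"
          proof (rule less.hyps[OF card])
            show "finite (T - {x0})" using less.prems(1) by simp
            show "finite ((`) (\<lambda>(y', w'). if y' = x0 then (y, w' + w) else (y', w')) ` ?C {{(y, w)}} x)"
              if "x \<in> T - {x0}" for x
              using that less.prems(2) by simp
            show "finite A'" if "x \<in> T - {x0}"
              "A' \<in> (`) (\<lambda>(y', w'). if y' = x0 then (y, w' + w) else (y', w')) ` ?C {{(y, w)}} x" for x A'
              using that less.prems(3) by fastforce
          qed
          show "finite (?C {{(y, w)}} x)" if "x \<in> T" for x using less.prems(2)[OF that] by simp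
          show "finite A'" if "x \<in> T" "A' \<in> ?C {{(y, w)}} x" for x A'
            using less.prems(3)[OF that(1)] that(2) by (cases "x = x0") simp_all
          show "?C {{(y, w)}} x0 = {{(y, w)}}" by simp
        qed (fact less.prems(1) x0 4)+
      qed
    qed
    have option: "pot_alt T (?C {A})" if "finite A" for A
      using that
    proof (induction A rule: finite_induct)
      case empty
      show ?case by (rule remove) auto
    next
      case (insert e A)
      show ?case using pot_alt_split_edges[OF x0 single[of "fst e" "snd e"] insert.IH] by (simp add: fun_upd_def)
    qed
    have "pot_alt T (?C P)" if "finite P" "\<And>A. A \<in> P \<Longrightarrow> finite A" for P
      using that
    proof (induction P rule: finite_induct)
      case empty
      have "eve_pot T (?C {}) {x0} (\<lambda>_. 0)" using x0 by (auto simp: eve_pot_def)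
      then show ?case by (rule pot_alt_eve[rotated]) simp
    next
      case (insert A P)
      show ?case using pot_alt_split_option[OF option[of A] insert.IH] insert.prems by (simp add: fun_upd_def)
    qed
    from this[of "ops x0"] show ?thesis using less.prems x0 by simp
  qed
qed

lemma finite_upper: "finite A \<Longrightarrow> \<exists>c. \<forall>a\<in>A. a \<le> (c::'a::linorder)"
  by (metis Max_ge)

text \<open>Maximality of the Eve part makes the potentials of the two players complementary.\<close>

theorem potential_decomposition:
  fixes ops :: "'x \<Rightarrow> ('x \<times> 'g::{linordered_ab_group_add, unbounded_dense_linorder}) set set"
  assumes fin: "finite T" "\<And>x. x \<in> T \<Longrightarrow> finite (ops x)" "\<And>x A. x \<in> T \<Longrightarrow> A \<in> ops x \<Longrightarrow> finite A"
  obtains E p q where "eve_pot T ops E p" "adam_pot (T - E) ops q"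
proof -
  define P where "P E \<longleftrightarrow> (\<exists>p. eve_pot T ops E p)" for E
  have "P {}" by (auto simp: P_def eve_pot_def)
  moreover have bound: "\<forall>E. P E \<longrightarrow> card E \<le> card T"
    using fin(1) by (auto simp: P_def eve_pot_def intro: card_mono)
  ultimately obtain E where E: "P E" "\<And>E'. P E' \<Longrightarrow> card E' \<le> card E"
    using ex_has_greatest_nat[of P "{}" card "Suc (card T)"] by (auto simp: less_Suc_eq_le)
  then obtain p where p: "eve_pot T ops E p" by (auto simp: P_def)
  have ET: "E \<subseteq> T" using p by (auto simp: eve_pot_def)
  have "\<exists>q. adam_pot (T - E) ops q"
  proof (rule ccontr)
    assume "\<not> ?thesis"
    moreover have "pot_alt (T - E) ops" by (rule potential_alternative) (use fin in auto)
    ultimately obtain Y p' where Y: "Y \<noteq> {}" "eve_pot (T - E) ops Y p'" by (metis pot_alt_cases)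
    have YT: "Y \<subseteq> T - E" using Y by (auto simp: eve_pot_def)
    \<comment> \<open>For Eve the play may leave \<open>T - E\<close> into \<open>E\<close>. Raising
      her potential on \<open>Y\<close> by a constant above all these differences makes each such
      edge satisfy the inequality with \<open>p\<close> on \<open>E\<close>, so
      \<open>E \<union> Y\<close> contradicts maximality.\<close>
    define D where "D = (\<Union>x\<in>Y. \<Union>A\<in>ops x. (\<lambda>(y, w). p y - p' x - w) ` A)"
    have "finite Y" using YT fin by (meson finite_Diff finite_subset)
    then have "finite D" unfolding D_def using fin YT by auto
    then obtain c where "\<forall>d\<in>D. d \<le> c" using finite_upper by auto
    then have c: "\<And>d. d \<in> D \<Longrightarrow> d \<le> c" by simp
    define p2 where "p2 x = (if x \<in> Y then p' x + c else p x)" for x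
    have "eve_pot T ops (E \<union> Y) p2"
      unfolding eve_pot_def
    proof (intro conjI ballI)
      show "E \<union> Y \<subseteq> T" using ET YT by auto
      fix x A assume x: "x \<in> E \<union> Y" and A: "A \<in> ops x"
      show "\<exists>(y, w)\<in>A. y \<notin> T \<or> (y \<in> E \<union> Y \<and> p2 y \<le> p2 x + w)"
      proof (cases "x \<in> Y")
        case True
        obtain y w where yw: "(y, w) \<in> A" "y \<notin> T - E \<or> (y \<in> Y \<and> p' y \<le> p' x + w)"
          using eve_potD[OF Y(2) True A] .
        have "p y \<le> p' x + c + w" using c[of "p y - p' x - w"] True A yw(1)
          unfolding D_def by (force simp: algebra_simps)
        then have "y \<notin> T \<or> (y \<in> E \<union> Y \<and> p2 y \<le> p2 x + w)"
          using yw(2) True YT by (auto simp: p2_def algebra_simps)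
        then show ?thesis using yw(1) by blast
      next
        case False
        then have xE: "x \<in> E" using x by blast
        obtain y w where yw: "(y, w) \<in> A" "y \<notin> T \<or> (y \<in> E \<and> p y \<le> p x + w)"
          using eve_potD[OF p xE A] .
        then have "y \<notin> T \<or> (y \<in> E \<union> Y \<and> p2 y \<le> p2 x + w)"
          using False YT by (auto simp: p2_def)
        then show ?thesis using yw(1) by blast
      qed
    qed
    then have "card (E \<union> Y) \<le> card E" using E by (auto simp: P_def)
    moreover have "card E < card (E \<union> Y)"
      by (rule psubset_card_mono) (use YT Y ET \<open>finite Y\<close> finite_subset[OF ET fin(1)] in auto)
    ultimately show False by simp
  qed
  then show ?thesis using that p by blast
qed

section \<open>Games on two counters\<close>

text \<open>The plane with the lexicographic order: the second component is infinitesimal against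
  the first. The potential theorems hold over any dense unbounded ordered abelian group, so they
  apply to such weights.\<close>

datatype lex2 = Lex2 (lex_fst: real) (lex_snd: real)

instantiation lex2 :: linordered_ab_group_add
begin
definition "0 = Lex2 0 0"
definition "x + y = Lex2 (lex_fst x + lex_fst y) (lex_snd x + lex_snd y)"
definition "- x = Lex2 (- lex_fst x) (- lex_snd x)"
definition "(x :: lex2) - y = Lex2 (lex_fst x - lex_fst y) (lex_snd x - lex_snd y)"
definition "x \<le> y \<longleftrightarrow> lex_fst x < lex_fst y \<or> lex_fst x = lex_fst y \<and> lex_snd x \<le> lex_snd y"
definition "(x :: lex2) < y \<longleftrightarrow> lex_fst x < lex_fst y \<or> lex_fst x = lex_fst y \<and> lex_snd x < lex_snd y"
instance
  by standard (auto simp: plus_lex2_def zero_lex2_def uminus_lex2_def minus_lex2_def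
      less_eq_lex2_def less_lex2_def lex2.expand)
end

instance lex2 :: unbounded_dense_linorder
proof
  fix x y :: lex2
  have b: "\<exists>z. Lex2 u v < z" "\<exists>z. z < Lex2 u v" for u v
    by (auto simp: less_lex2_def intro: exI[of _ "Lex2 (u + 1) v"] exI[of _ "Lex2 (u - 1) v"])
  show "\<exists>z. x < z" "\<exists>z. z < x" using b by (cases x; blast)+
  assume "x < y"
  then consider "lex_fst x < lex_fst y" | "lex_fst x = lex_fst y" "lex_snd x < lex_snd y"
    by (auto simp: less_lex2_def)
  then show "\<exists>z. x < z \<and> z < y"
  proof cases
    case 1
    then obtain u where "lex_fst x < u" "u < lex_fst y" using dense by blast
    then show ?thesis by (intro exI[of _ "Lex2 u 0"]) (auto simp: less_lex2_def)
  next
    case 2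
    then obtain v where "lex_snd x < v" "v < lex_snd y" using dense by blast
    then show ?thesis using 2 by (intro exI[of _ "Lex2 (lex_fst x) v"]) (auto simp: less_lex2_def)
  qed
qed

text \<open>\<^term>\<open>H x m h\<close> says that Eve wins in state \<^term>\<open>x\<close> when Adam's counter is \<^term>\<open>m\<close> and hers
  is \<^term>\<open>h\<close>; an edge \<^term>\<open>(y, d, e)\<close> changes these counters by \<^term>\<open>d\<close> and \<^term>\<open>e\<close>. Adam picks an
  option, Eve an edge of it. Column \<^term>\<open>0\<close> is an arbitrary boundary.\<close>

locale counter_game =
  fixes X :: "'x set" and opts :: "'x \<Rightarrow> ('x \<times> int \<times> int) set set" and H :: "'x \<Rightarrow> int \<Rightarrow> int \<Rightarrow> bool"
  assumes finite_X: "finite X"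
    and finite_opts: "x \<in> X \<Longrightarrow> finite (opts x)"
    and finite_opt: "x \<in> X \<Longrightarrow> A \<in> opts x \<Longrightarrow> finite A"
    and edge: "x \<in> X \<Longrightarrow> A \<in> opts x \<Longrightarrow> (y, d, e) \<in> A \<Longrightarrow> y \<in> X \<and> d \<in> {-1, 0, 1} \<and> e \<in> {-1, 0, 1}"
    and nonneg: "H x m h \<Longrightarrow> 0 \<le> h"
    and rule: "x \<in> X \<Longrightarrow> 1 \<le> m \<Longrightarrow> H x m h \<Longrightarrow> A \<in> opts x \<Longrightarrow> \<exists>(y, d, e)\<in>A. H y (m + d) (h + e)"
    and coind: "\<lbrakk>\<And>x m h. K x m h \<Longrightarrow> x \<in> X \<and> 0 \<le> m \<and> 0 \<le> h \<and>
          (H x m h \<or> 1 \<le> m \<and> (\<forall>A\<in>opts x. \<exists>(y, d, e)\<in>A. K y (m + d) (h + e) \<or> H y (m + d) (h + e)));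
        K x m h\<rbrakk> \<Longrightarrow> H x m h"
    and mono: "H x m h \<Longrightarrow> h \<le> h' \<Longrightarrow> H x m h'"
    and boundary: "x \<in> X \<Longrightarrow> \<exists>h. H x 0 h"
begin

section \<open>Linear bounds on Eve's winning region\<close>

definition upper :: "'x set \<Rightarrow> real \<Rightarrow> bool" where
  "upper S \<theta> \<longleftrightarrow> (\<exists>C. \<forall>x\<in>S. \<forall>m h. 0 \<le> m \<longrightarrow> \<theta> * of_int m + C \<le> of_int h \<longrightarrow> H x m h)"

text \<open>With \<open>f m\<close> the least winning counter value of Eve, \<open>upper\<close>
  says \<open>f m \<le> \<theta> m + C\<close> up to rounding and \<open>lower\<close> says
  \<open>\<theta> m - C \<le> f m\<close>. Avoiding \<open>f\<close> lets \<open>lower\<close> cover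
  columns in which Eve never wins.\<close>

definition lower :: "'x set \<Rightarrow> real \<Rightarrow> bool" where
  "lower S \<theta> \<longleftrightarrow> (\<exists>C. \<forall>x\<in>S. \<forall>m h. 0 \<le> m \<longrightarrow> H x m h \<longrightarrow> \<theta> * of_int m - C \<le> of_int h)"

definition weighted :: "(int \<Rightarrow> int \<Rightarrow> 'g) \<Rightarrow> 'x \<Rightarrow> ('x \<times> 'g) set set" where
  "weighted W x = (`) (\<lambda>(y, d, e). (y, W d e)) ` opts x"

lemma upper_mono:
  assumes "upper S \<theta>" "\<theta> \<le> \<theta>'" shows "upper S \<theta>'"
proof -
  obtain C where C: "\<forall>x\<in>S. \<forall>m h. 0 \<le> m \<longrightarrow> \<theta> * of_int m + C \<le> of_int h \<longrightarrow> H x m h"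
    using assms unfolding upper_def by blast
  have "\<theta> * of_int m + C \<le> of_int h" if "0 \<le> m" "\<theta>' * of_int m + C \<le> of_int h" for m h :: int
    using that assms(2) mult_right_mono[of \<theta> \<theta>' "of_int m"] by simp
  then show ?thesis using C unfolding upper_def by blast
qed

lemma lower_mono:
  assumes "lower S \<theta>" "\<theta>' \<le> \<theta>" "S' \<subseteq> S" shows "lower S' \<theta>'"
proof -
  obtain C where C: "\<forall>x\<in>S. \<forall>m h. 0 \<le> m \<longrightarrow> H x m h \<longrightarrow> \<theta> * of_int m - C \<le> of_int h"
    using assms unfolding lower_def by blast
  have "\<theta>' * of_int m - C \<le> of_int h" if "0 \<le> m" "\<theta> * of_int m - C \<le> of_int h" for m h :: int
    using that assms(2) mult_right_mono[of \<theta>' \<theta> "of_int m"] by simp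
  then show ?thesis using C assms(3) unfolding lower_def by blast
qed

lemma upper_Un:
  assumes "upper S \<theta>" "upper S' \<theta>" shows "upper (S \<union> S') \<theta>"
proof -
  obtain C where C: "\<forall>x\<in>S. \<forall>m h. 0 \<le> m \<longrightarrow> \<theta> * of_int m + C \<le> of_int h \<longrightarrow> H x m h"
    using assms unfolding upper_def by blast
  obtain C' where C': "\<forall>x\<in>S'. \<forall>m h. 0 \<le> m \<longrightarrow> \<theta> * of_int m + C' \<le> of_int h \<longrightarrow> H x m h"
    using assms unfolding upper_def by blast
  have "\<theta> * of_int m + C \<le> of_int h" "\<theta> * of_int m + C' \<le> of_int h"
    if "\<theta> * of_int m + max C C' \<le> of_int h" for m h :: int
    using that by linarith+
  then show ?thesis using C C' unfolding upper_def by (intro exI[of _ "max C C'"]) blast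
qed

lemma lower_0: "lower S 0"
  unfolding lower_def using nonneg by (intro exI[of _ 0]) auto

lemma boundary_bound: "\<exists>F. \<forall>x\<in>X. \<forall>h\<ge>F. H x 0 h"
proof -
  obtain f where f: "\<And>x. x \<in> X \<Longrightarrow> H x 0 (f x)" using boundary by metis
  obtain F where "\<forall>a\<in>f ` X. a \<le> F" using finite_upper[of "f ` X"] finite_X by auto
  then show ?thesis using f mono by (meson imageI order_trans)
qed

text \<open>The potential inequality says exactly that the distance of Eve's counter above the line,
  corrected by \<open>p\<close>, never drops. Staying above is therefore coinductive, until the play
  exits to \<open>S\<close> or reaches column 0.\<close>

lemma upper_of_eve_pot:
  assumes Y: "Y \<subseteq> X" and S: "upper S \<theta>" and \<theta>: "0 \<le> \<theta>"
    and p: "\<And>x A. x \<in> Y \<Longrightarrow> A \<in> opts x \<Longrightarrow>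
      \<exists>(y, d, e)\<in>A. y \<in> S \<or> (y \<in> Y \<and> p y \<le> p x + (of_int e - \<theta> * of_int d))"
  shows "upper Y \<theta>"
proof -
  obtain CS where CS: "\<And>x m h. x \<in> S \<Longrightarrow> 0 \<le> m \<Longrightarrow> \<theta> * of_int m + CS \<le> of_int h \<Longrightarrow> H x m h"
    using S unfolding upper_def by blast
  obtain F where F: "\<And>x h. x \<in> X \<Longrightarrow> h \<ge> F \<Longrightarrow> H x 0 h" using boundary_bound by blast
  have fY: "finite Y" using Y finite_X finite_subset by blast
  then obtain P where "\<forall>a\<in>(\<lambda>x. \<bar>p x\<bar>) ` Y. a \<le> P" using finite_upper[of "(\<lambda>x. \<bar>p x\<bar>) ` Y"] by auto
  then have P: "\<bar>p x\<bar> \<le> P" if "x \<in> Y" for x using that by auto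
  \<comment> \<open>\<open>P\<close> absorbs the potential, \<open>\<bar>CS\<bar>\<close> pays for
    an exit to \<open>S\<close>, \<open>\<bar>of_int F\<bar>\<close> for arrival in column 0, and
    \<open>\<theta> + 1\<close> for a last round with \<open>d = 1\<close> and
    \<open>e = -1\<close>.\<close>
  define C where "C = P + \<bar>CS\<bar> + \<bar>of_int F\<bar> + \<theta> + 1"
  define K where "K x m h \<longleftrightarrow> x \<in> Y \<and> 0 \<le> m \<and> \<theta> * of_int m + p x + C \<le> of_int h" for x m h
  have K: "H x m h" if "K x m h" for x m h
  proof (rule coind[of K, OF _ that])
    fix x m h assume K: "K x m h"
    then have xY: "x \<in> Y" and xX: "x \<in> X" and m: "0 \<le> m" and h: "\<theta> * of_int m + p x + C \<le> of_int h"
      using Y by (auto simp: K_def)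
    have tm: "0 \<le> \<theta> * of_int m" using m \<theta> by simp
    have h1: "\<theta> * of_int m + \<bar>CS\<bar> + \<bar>of_int F\<bar> + \<theta> + 1 \<le> of_int h"
      using h P[OF xY] unfolding C_def by linarith
    have "0 \<le> h" using h1 tm \<theta> by linarith
    moreover have "H x m h" if "m = 0"
    proof -
      have "of_int F \<le> (of_int h :: real)" using h1 tm \<theta> by linarith
      then show ?thesis using F xX that by simp
    qed
    moreover have "\<exists>(y, d, e)\<in>A. K y (m + d) (h + e) \<or> H y (m + d) (h + e)"
      if A: "A \<in> opts x" and m1: "1 \<le> m" for A
    proof -
      obtain y d e where yde: "(y, d, e) \<in> A"
        "y \<in> S \<or> (y \<in> Y \<and> p y \<le> p x + (of_int e - \<theta> * of_int d))"
        using p[OF xY A] by blast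
      have de: "d \<in> {-1, 0, 1}" "e \<in> {-1, 0, 1}" using edge[OF xX A yde(1)] by auto
      then have m': "0 \<le> m + d" using m1 by auto
      have "K y (m + d) (h + e) \<or> H y (m + d) (h + e)"
      proof (cases "y \<in> S")
        case True
        have "\<theta> * of_int d \<le> \<theta>" "(-1::real) \<le> of_int e" using de \<theta> by auto
        then have "\<theta> * of_int (m + d) + CS \<le> of_int (h + e)"
          using h1 by (simp add: distrib_left)
        then show ?thesis using CS[OF True m'] by blast
      next
        case False
        then have "y \<in> Y" "p y \<le> p x + (of_int e - \<theta> * of_int d)" using yde by auto
        then have "K y (m + d) (h + e)" unfolding K_def using m' h by (simp add: distrib_left)
        then show ?thesis ..
      qed
      then show ?thesis using yde(1) by blast
    qed
    ultimately show "x \<in> X \<and> 0 \<le> m \<and> 0 \<le> h \<and>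
          (H x m h \<or> 1 \<le> m \<and> (\<forall>A\<in>opts x. \<exists>(y, d, e)\<in>A. K y (m + d) (h + e) \<or> H y (m + d) (h + e)))"
      using xX m by (cases "m = 0") auto
  qed
  have "\<theta> * of_int m + p x + C \<le> of_int h" if "x \<in> Y" "\<theta> * of_int m + (P + C) \<le> of_int h" for x and m h :: int
    using P[OF that(1)] that(2) by linarith
  then show ?thesis unfolding upper_def using K unfolding K_def by blast
qed

text \<open>The potential \<^term>\<open>q\<close> keeps the play below a line of slope \<^term>\<open>\<theta>\<close>; \<^term>\<open>r\<close> drives it below every
  line of slope \<^term>\<open>\<phi>\<close>, where Eve is known to lose.\<close>

lemma lower_of_adam_pot:
  assumes A: "A \<subseteq> X" and low: "lower A \<phi>" and \<delta>: "0 < \<delta>"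
    and opt: "\<And>x. x \<in> A \<Longrightarrow> \<exists>B\<in>opts x. \<forall>(y, d, e)\<in>B. y \<in> A \<and>
        of_int e - \<theta> * of_int d + q y \<le> q x \<and> of_int e - \<phi> * of_int d + r y \<le> r x - \<delta>"
  shows "lower A \<theta>"
proof -
  obtain C where C: "\<And>x m h. x \<in> A \<Longrightarrow> 0 \<le> m \<Longrightarrow> H x m h \<Longrightarrow> \<phi> * of_int m - C \<le> of_int h"
    using low unfolding lower_def by blast
  have fA: "finite A" using A finite_X finite_subset by blast
  obtain Q where "\<forall>a\<in>(\<lambda>x. \<bar>q x\<bar>) ` A. a \<le> Q" using finite_upper[of "(\<lambda>x. \<bar>q x\<bar>) ` A"] fA by auto
  then have Q: "\<bar>q x\<bar> \<le> Q" if "x \<in> A" for x using that by auto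
  obtain R where "\<forall>a\<in>(\<lambda>x. \<bar>r x\<bar>) ` A. a \<le> R" using finite_upper[of "(\<lambda>x. \<bar>r x\<bar>) ` A"] fA by auto
  then have R: "\<bar>r x\<bar> \<le> R" if "x \<in> A" for x using that by auto
  \<comment> \<open>Adam's options are followed against Eve's winning replies. The height over the
    line of slope \<open>\<phi>\<close>, corrected by \<open>r\<close>, stays nonnegative by
    \<open>low\<close> and loses \<open>\<delta>\<close> per round, so \<open>n\<close> bounds the
    rounds left. The play must end in column 0, where \<open>0 \<le> h\<close>, and \<open>q\<close>
    carries this bound back.\<close>
  have main: "- Q \<le> of_int h - \<theta> * of_int m + q x"
    if "x \<in> A" "0 \<le> m" "H x m h" "of_int h - \<phi> * of_int m + r x + C + R \<le> \<delta> * of_nat n" for n x m h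
    using that
  proof (induction n arbitrary: x m h rule: less_induct)
    case (less n)
    show ?case
    proof (cases "m = 0")
      case True
      then show ?thesis using nonneg[OF less.prems(3)] Q[OF less.prems(1)] by simp
    next
      case False
      then have m1: "1 \<le> m" using less.prems by simp
      have xX: "x \<in> X" using A less.prems by blast
      obtain B where B: "B \<in> opts x" "\<forall>(y, d, e)\<in>B. y \<in> A \<and>
        of_int e - \<theta> * of_int d + q y \<le> q x \<and> of_int e - \<phi> * of_int d + r y \<le> r x - \<delta>"
        using opt[OF less.prems(1)] by blast
      obtain y d e where yde: "(y, d, e) \<in> B" "H y (m + d) (h + e)"
        using rule[OF xX m1 less.prems(3) B(1)] by blast
      have y: "y \<in> A" "of_int e - \<theta> * of_int d + q y \<le> q x" "of_int e - \<phi> * of_int d + r y \<le> r x - \<delta>"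
        using B(2) yde(1) by auto
      have m': "0 \<le> m + d" using edge[OF xX B(1) yde(1)] m1 by auto
      have "0 \<le> of_int (h + e) - \<phi> * of_int (m + d) + r y + C + R"
        using C[OF y(1) m' yde(2)] R[OF y(1)] by linarith
      also have dec: "\<dots> \<le> of_int h - \<phi> * of_int m + r x + C + R - \<delta>"
        using y(3) by (simp add: distrib_left)
      finally have "\<delta> \<le> \<delta> * of_nat n" using less.prems(4) by linarith
      then have n: "n > 0" using \<delta> by (cases n) auto
      have "of_int (h + e) - \<phi> * of_int (m + d) + r y + C + R \<le> \<delta> * of_nat (n - 1)"
        using dec less.prems(4) n by (simp add: of_nat_diff algebra_simps)
      then have "- Q \<le> of_int (h + e) - \<theta> * of_int (m + d) + q y"
        using less.IH[of "n - 1" y "m + d" "h + e"] n y(1) m' yde(2) by simp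
      then show ?thesis using y(2) by (simp add: distrib_left)
    qed
  qed
  have "\<theta> * of_int m - 2 * Q \<le> of_int h" if x: "x \<in> A" "0 \<le> m" "H x m h" for x m h
  proof -
    obtain n where "(of_int h - \<phi> * of_int m + r x + C + R) / \<delta> \<le> of_nat n" using real_arch_simple by blast
    then have "of_int h - \<phi> * of_int m + r x + C + R \<le> \<delta> * of_nat n"
      using \<delta> by (simp add: field_simps)
    from main[OF x this] show ?thesis using Q[OF x(1)] by linarith
  qed
  then show ?thesis unfolding lower_def by blast
qed

text \<open>Decomposition for the counter game restricted to \<open>T\<close>. The exits conceded to
  Eve lead to \<open>X - T\<close>, which in the applications is already known to have a small
  slope.\<close>

lemma split_by_potential:
  fixes W :: "int \<Rightarrow> int \<Rightarrow> 'g::{linordered_ab_group_add, unbounded_dense_linorder}"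
  assumes T: "T \<subseteq> X"
  obtains E p q where "E \<subseteq> T"
    "\<And>x A. x \<in> E \<Longrightarrow> A \<in> opts x \<Longrightarrow> \<exists>(y, d, e)\<in>A. y \<in> X - T \<or> (y \<in> E \<and> p y \<le> p x + W d e)"
    "\<And>x. x \<in> T - E \<Longrightarrow> \<exists>B\<in>opts x. \<forall>(y, d, e)\<in>B. y \<in> T - E \<and> W d e + q y < q x"
proof -
  have "finite (weighted W x)" if "x \<in> T" for x
    unfolding weighted_def using finite_opts T that by blast
  moreover have "finite A" if "x \<in> T" "A \<in> weighted W x" for x A
    using finite_opt T that unfolding weighted_def by blast
  moreover have "finite T" using T finite_X finite_subset by blast
  ultimately obtain E p q where E: "eve_pot T (weighted W) E p" and q: "adam_pot (T - E) (weighted W) q"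
    using potential_decomposition[of T "weighted W"] by blast
  show thesis
  proof (rule that[of E p q])
    show ET: "E \<subseteq> T" using E unfolding eve_pot_def by blast
    fix x A assume x: "x \<in> E" and A: "A \<in> opts x"
    then have "(\<lambda>(y, d, e). (y, W d e)) ` A \<in> weighted W x" unfolding weighted_def by blast
    then obtain y w where yw: "(y, w) \<in> (\<lambda>(y, d, e). (y, W d e)) ` A" "y \<notin> T \<or> (y \<in> E \<and> p y \<le> p x + w)"
      using eve_potD[OF E x] by blast
    then obtain d e where "(y, d, e) \<in> A" "w = W d e" by auto
    moreover have "y \<in> X" using calculation edge A x ET T by blast
    ultimately show "\<exists>(y, d, e)\<in>A. y \<in> X - T \<or> (y \<in> E \<and> p y \<le> p x + W d e)"
      using yw(2) by blast
  next
    fix x assume "x \<in> T - E"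
    then have "\<exists>A\<in>weighted W x. \<forall>(y, w)\<in>A. y \<in> T - E \<and> w + q y < q x"
      using q unfolding adam_pot_def by blast
    then show "\<exists>B\<in>opts x. \<forall>(y, d, e)\<in>B. y \<in> T - E \<and> W d e + q y < q x"
      unfolding weighted_def by fastforce
  qed
qed

section \<open>Classification of states by asymptotic slope\<close>

lemma finite_edges: "T \<subseteq> X \<Longrightarrow> finite (\<Union>x\<in>T. \<Union>A\<in>opts x. (\<lambda>(y, d, e). g x y d e) ` A)"
  using finite_subset[OF _ finite_X] finite_opts finite_opt by (intro finite_UN_I finite_imageI) auto

text \<open>There are finitely many edges, so strict inequalities along them hold with a uniform
  margin.\<close>

lemma edge_slack:
  fixes g :: "'x \<Rightarrow> 'x \<Rightarrow> int \<Rightarrow> int \<Rightarrow> real"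
  assumes "T \<subseteq> X"
  obtains \<delta> where "0 < \<delta>"
    "\<And>x A y d e. x \<in> T \<Longrightarrow> A \<in> opts x \<Longrightarrow> (y, d, e) \<in> A \<Longrightarrow> 0 < g x y d e \<Longrightarrow> \<delta> \<le> g x y d e"
proof -
  define D where "D = {a\<in>(\<Union>x\<in>T. \<Union>A\<in>opts x. (\<lambda>(y, d, e). g x y d e) ` A). 0 < a}"
  have "finite D"
    unfolding D_def by (rule finite_subset[OF _ finite_edges[OF assms, of g]]) blast
  moreover have "0 < a" if "a \<in> D" for a using that by (simp add: D_def)
  ultimately obtain \<delta> where \<delta>: "0 < \<delta>" "\<forall>a\<in>D. \<delta> < a"
    using finite_dense_between by meson
  show thesis
  proof (rule that[OF \<delta>(1)])
    fix x A y d e assume *: "x \<in> T" "A \<in> opts x" "(y, d, e) \<in> A" "0 < g x y d e"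
    then have "g x y d e \<in> D" unfolding D_def by force
    then show "\<delta> \<le> g x y d e" using \<delta>(2) by force
  qed
qed

text \<open>Weights of slope \<open>\<theta>\<close> separate \<open>R\<close>. On Eve's part the
  bound is immediate. On Adam's part every edge has a margin, and since \<open>d\<close> is at most
  1 in absolute value, a slight change of slope in either direction costs at most half of it. Thus
  one potential holds the play below a line of larger slope and drives it below a smaller slope,
  which \<open>low\<close> forbids.\<close>

lemma peel:
  assumes R: "R \<subseteq> X" and \<theta>: "0 \<le> \<theta>" and S: "upper (X - R) \<theta>" and low: "\<And>\<phi>. \<phi> < \<theta> \<Longrightarrow> lower R \<phi>"
  obtains E \<delta> where "E \<subseteq> R" "upper E \<theta>" "0 < \<delta>" "lower (R - E) (\<theta> + \<delta>)"
proof -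
  let ?W = "\<lambda>d e. real_of_int e - \<theta> * of_int d"
  obtain E p q where E: "E \<subseteq> R"
    and p: "\<And>x A. x \<in> E \<Longrightarrow> A \<in> opts x \<Longrightarrow> \<exists>(y, d, e)\<in>A. y \<in> X - R \<or> (y \<in> E \<and> p y \<le> p x + ?W d e)"
    and q: "\<And>x. x \<in> R - E \<Longrightarrow> \<exists>B\<in>opts x. \<forall>(y, d, e)\<in>B. y \<in> R - E \<and> ?W d e + q y < q x"
    using split_by_potential[OF R, of ?W] by blast
  obtain \<delta> where \<delta>: "0 < \<delta>" "\<And>x A y d e. x \<in> R - E \<Longrightarrow> A \<in> opts x \<Longrightarrow> (y, d, e) \<in> A \<Longrightarrow>
      0 < q x - (?W d e + q y) \<Longrightarrow> \<delta> \<le> q x - (?W d e + q y)"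
    using edge_slack[of "R - E" "\<lambda>x y d e. q x - (?W d e + q y)"] R by blast
  have "upper E \<theta>" using upper_of_eve_pot[OF _ S \<theta> p] E R by blast
  moreover have "lower (R - E) (\<theta> + \<delta> / 2)"
  proof (rule lower_of_adam_pot[where \<phi> = "\<theta> - \<delta> / 2" and \<delta> = "\<delta> / 2" and q = q and r = q])
    show "lower (R - E) (\<theta> - \<delta> / 2)" using low[of "\<theta> - \<delta> / 2"] \<delta>(1) lower_mono by auto
    fix x assume x: "x \<in> R - E"
    then obtain B where B: "B \<in> opts x" "\<forall>(y, d, e)\<in>B. y \<in> R - E \<and> ?W d e + q y < q x"
      using q by blast
    have main: "case z of (y, d, e) \<Rightarrow> y \<in> R - E \<and> of_int e - (\<theta> + \<delta> / 2) * of_int d + q y \<le> q x \<and>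
        of_int e - (\<theta> - \<delta> / 2) * of_int d + q y \<le> q x - \<delta> / 2" if "z \<in> B" for z
    proof (cases z)
      case (fields y d e)
      then have yde: "(y, d, e) \<in> B" using that by simp
      have y: "y \<in> R - E" "?W d e + q y < q x" using B(2) yde by auto
      have *: "?W d e + q y \<le> q x - \<delta>" using \<delta>(2)[OF x B(1) yde] y(2) by simp
      have "d \<in> {-1, 0, 1}" using edge[OF _ B(1) yde] x R by blast
      then show ?thesis using y(1) * \<delta>(1) unfolding fields by (auto simp: field_simps)
    qed
    show "\<exists>B\<in>opts x. \<forall>(y, d, e)\<in>B. y \<in> R - E \<and> of_int e - (\<theta> + \<delta> / 2) * of_int d + q y \<le> q x \<and>
        of_int e - (\<theta> - \<delta> / 2) * of_int d + q y \<le> q x - \<delta> / 2"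
      by (intro bexI[OF _ B(1)] ballI main)
  qed (use R \<delta>(1) in auto)
  ultimately show thesis using that[of E "\<delta> / 2"] E \<delta>(1) by simp
qed

text \<open>Slopes below 1 are peeled off one after another. Each round enlarges \<open>S\<close>,
  so a set of maximal cardinality leaves only states whose lower slopes reach every value below
  1.\<close>

lemma steep_part:
  obtains S \<theta> where "S \<subseteq> X" "\<theta> < 1" "upper S \<theta>" "\<And>\<phi>. \<phi> < 1 \<Longrightarrow> lower (X - S) \<phi>"
proof -
  define P where "P S \<longleftrightarrow> S \<subseteq> X \<and> (\<exists>\<theta> \<theta>'. \<theta> < 1 \<and> \<theta> < \<theta>' \<and> upper S \<theta> \<and> lower (X - S) \<theta>')" for S
  \<comment> \<open>The start uses slopes -1 and 0: the upper bound is vacuous and the lower one is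
    nonnegativity of Eve's counter.\<close>
  have "P {}" unfolding P_def using lower_0 upper_def by (intro conjI exI[of _ "-1"] exI[of _ 0]) auto
  moreover have "\<forall>S. P S \<longrightarrow> card S < Suc (card X)"
    using finite_X by (auto simp: P_def less_Suc_eq_le intro: card_mono)
  ultimately obtain S where S: "P S" "\<And>S'. P S' \<Longrightarrow> card S' \<le> card S"
    using ex_has_greatest_nat[of P "{}" card "Suc (card X)"] by auto
  then obtain \<theta> \<theta>' where \<theta>: "S \<subseteq> X" "\<theta> < 1" "\<theta> < \<theta>'" "upper S \<theta>" "lower (X - S) \<theta>'"
    unfolding P_def by blast
  have "lower (X - S) \<phi>" if "\<phi> < 1" for \<phi>
  proof (rule ccontr)
    assume n: "\<not> lower (X - S) \<phi>"
    define L where "L = {\<psi>. lower (X - S) \<psi>}"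
    have bd: "\<psi> \<le> \<phi>" if "\<psi> \<in> L" for \<psi>
      using that n lower_mono[of "X - S" \<psi> \<phi> "X - S"] unfolding L_def by fastforce
    then have bdd: "bdd_above L" by (auto simp: bdd_above_def)
    \<comment> \<open>The supremum of valid lower slopes is the next slope to peel. It exceeds
      \<open>\<theta>\<close> because \<open>\<theta>'\<close> is a valid lower slope, and stays
      below 1 because \<open>\<phi>\<close> bounds it.\<close>
    define \<theta>1 where "\<theta>1 = Sup L"
    have up: "\<psi> \<le> \<theta>1" if "lower (X - S) \<psi>" for \<psi>
      unfolding \<theta>1_def using that bdd by (intro cSup_upper) (auto simp: L_def)
    have ne: "L \<noteq> {}" using lower_0 by (auto simp: L_def)
    have \<theta>1: "0 \<le> \<theta>1" "\<theta> < \<theta>1" "\<theta>1 < 1"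
      using up[OF lower_0] up[OF \<theta>(5)] \<theta>(3) cSup_least[OF ne bd] that unfolding \<theta>1_def by auto
    have low: "lower (X - S) \<psi>" if \<psi>: "\<psi> < \<theta>1" for \<psi>
    proof -
      obtain \<psi>' where "\<psi>' \<in> L" "\<psi> < \<psi>'" using less_cSup_iff[OF ne bdd] \<psi> unfolding \<theta>1_def by blast
      then show ?thesis using lower_mono[of "X - S" \<psi>' \<psi> "X - S"] by (auto simp: L_def)
    qed
    have "X - (X - S) = S" using \<theta>(1) by blast
    then have "upper (X - (X - S)) \<theta>1" using upper_mono[OF \<theta>(4), of \<theta>1] \<theta>1(2) by simp
    then obtain E \<delta> where E: "E \<subseteq> X - S" "upper E \<theta>1" "0 < \<delta>" "lower (X - S - E) (\<theta>1 + \<delta>)"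
      by (rule peel[OF Diff_subset \<theta>1(1) _ low])
    have "upper (S \<union> E) \<theta>1" using upper_Un upper_mono[OF \<theta>(4)] \<theta>1(2) E(2) by simp
    moreover have "lower (X - (S \<union> E)) (\<theta>1 + \<delta>)" using E(4) by (simp add: Diff_Un set_diff_eq)
    ultimately have "P (S \<union> E)"
      unfolding P_def using E(1,3) \<theta>(1) \<theta>1 by (intro conjI exI[of _ \<theta>1] exI[of _ "\<theta>1 + \<delta>"]) auto
    then have "card (S \<union> E) \<le> card S" by (rule S(2))
    moreover have "finite (S \<union> E)" using E(1) \<theta>(1) finite_X finite_subset by auto
    ultimately have "S \<union> E = S" using card_seteq[of "S \<union> E" S] by blast
    \<comment> \<open>If nothing is peeled off, all of \<open>X - S\<close> has a lower slope beyond
      the supremum.\<close>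
    then have "E = {}" using E(1) by blast
    then show False using E(3,4) up[of "\<theta>1 + \<delta>"] by simp
  qed
  then show thesis using that \<theta> by blast
qed

lemma upper_lower_contra:
  assumes "x \<in> S" "upper S \<theta>" "x \<in> R" "lower R \<phi>" "\<theta> < \<phi>"
  shows False
proof -
  obtain C where C: "\<And>m h. 0 \<le> m \<Longrightarrow> \<theta> * of_int m + C \<le> of_int h \<Longrightarrow> H x m h"
    using assms(1,2) unfolding upper_def by blast
  obtain C' where C': "\<And>m h. 0 \<le> m \<Longrightarrow> H x m h \<Longrightarrow> \<phi> * of_int m - C' \<le> of_int h"
    using assms(3,4) unfolding lower_def by blast
  \<comment> \<open>In this column the two lines are further apart than the constants allow; the
    summand 1 covers the ceiling below.\<close>
  obtain n :: nat where n: "(\<bar>C\<bar> + \<bar>C'\<bar> + 1) / (\<phi> - \<theta>) < of_nat n" using reals_Archimedean2 by blast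
  then have n': "\<bar>C\<bar> + \<bar>C'\<bar> + 1 < (\<phi> - \<theta>) * of_nat n" using assms(5) by (simp add: field_simps)
  let ?h = "\<lceil>\<theta> * of_int (int n) + C\<rceil>"
  have "H x (int n) ?h" by (rule C) auto
  then have "\<phi> * of_int (int n) - C' \<le> of_int ?h" by (intro C') auto
  moreover have "of_int ?h < \<theta> * of_int (int n) + C + 1" by linarith
  ultimately show False using n' by (simp add: algebra_simps)
qed

text \<open>Lexicographic weights stand for a slope infinitesimally smaller than 1: they make Adam's
  potential bound the play by the line of slope 1 and, on ties, push it towards column 0.\<close>

lemma lower_1:
  assumes R: "R \<subseteq> X" and \<theta>: "\<theta> < 1" and S: "upper (X - R) \<theta>" and low: "\<And>\<phi>. \<phi> < 1 \<Longrightarrow> lower R \<phi>"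
  shows "lower R 1"
proof -
  let ?W = "\<lambda>d e. Lex2 (real_of_int (e - d)) (real_of_int d)"
  obtain E p q where E: "E \<subseteq> R"
    and p: "\<And>x A. x \<in> E \<Longrightarrow> A \<in> opts x \<Longrightarrow> \<exists>(y, d, e)\<in>A. y \<in> X - R \<or> (y \<in> E \<and> p y \<le> p x + ?W d e)"
    and q: "\<And>x. x \<in> R - E \<Longrightarrow> \<exists>B\<in>opts x. \<forall>(y, d, e)\<in>B. y \<in> R - E \<and> ?W d e + q y < q x"
    using split_by_potential[OF R, of ?W] by blast
  define p1 where "p1 x = lex_fst (p x)" for x
  define p2 where "p2 x = lex_snd (p x)" for x
  define q1 where "q1 x = lex_fst (q x)" for x
  define q2 where "q2 x = lex_snd (q x)" for x
  have plt: "p y \<le> p x + ?W d e \<longleftrightarrow> p1 y < p1 x + (of_int e - of_int d) \<or>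
      (p1 y = p1 x + (of_int e - of_int d) \<and> p2 y \<le> p2 x + of_int d)" for x y d e
    by (simp add: less_eq_lex2_def plus_lex2_def p1_def p2_def)
  have qlt: "?W d e + q y < q x \<longleftrightarrow> of_int e - of_int d + q1 y < q1 x \<or>
      (of_int e - of_int d + q1 y = q1 x \<and> of_int d + q2 y < q2 x)" for x y d e
    by (simp add: less_lex2_def plus_lex2_def q1_def q2_def)
  \<comment> \<open>On \<open>E\<close>, replacing the infinitesimal by a small real
    \<open>\<epsilon>\<close> would give an upper slope \<open>1 - \<epsilon>\<close>, against the
    lower slope \<open>1 - \<epsilon> / 2\<close> supplied by \<open>low\<close>.\<close>
  have "E = {}"
  proof (rule ccontr)
    assume "E \<noteq> {}"
    then obtain x0 where x0: "x0 \<in> E" by blast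
    have EX: "E \<subseteq> X" using E R by blast
    obtain \<delta> where \<delta>: "0 < \<delta>" "\<And>x A y d e. x \<in> E \<Longrightarrow> A \<in> opts x \<Longrightarrow> (y, d, e) \<in> A \<Longrightarrow>
        0 < p1 x + (of_int e - of_int d) - p1 y \<Longrightarrow> \<delta> \<le> p1 x + (of_int e - of_int d) - p1 y"
      using edge_slack[OF EX, of "\<lambda>x y d e. p1 x + (of_int e - of_int d) - p1 y"] by blast
    let ?D = "(\<Union>x\<in>E. \<Union>A\<in>opts x. (\<lambda>(y, d, e). p2 y - p2 x - of_int d) ` A)"
    obtain c where "\<forall>a\<in>?D. a \<le> c"
      using finite_upper[OF finite_edges[OF EX, of "\<lambda>x y d e. p2 y - p2 x - of_int d"]] by blast
    then have c: "p2 y - p2 x - of_int d \<le> c" if "x \<in> E" "A \<in> opts x" "(y, d, e) \<in> A" for x A y d e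
      using that by force
    \<comment> \<open>An edge with slack in the first component has at least \<open>\<delta>\<close>
      of it, while the second component can cost at most \<open>\<epsilon> * c\<close>. The other
      bounds keep the slope \<open>1 - \<epsilon>\<close> nonnegative and not below
      \<open>\<theta>\<close>.\<close>
    define \<epsilon> where "\<epsilon> = min (\<delta> / (\<bar>c\<bar> + 1)) (min 1 (1 - \<theta>))"
    have \<epsilon>: "0 < \<epsilon>" "\<epsilon> \<le> 1" "\<theta> \<le> 1 - \<epsilon>" using \<delta>(1) \<theta> by (auto simp: \<epsilon>_def)
    have "\<epsilon> * (\<bar>c\<bar> + 1) \<le> \<delta>"
    proof -
      have "\<epsilon> \<le> \<delta> / (\<bar>c\<bar> + 1)" by (simp add: \<epsilon>_def)
      then show ?thesis by (simp add: field_simps)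
    qed
    then have \<epsilon>c: "\<epsilon> * c \<le> \<delta>" using \<epsilon>(1) mult_left_mono[of c "\<bar>c\<bar> + 1" \<epsilon>] by linarith
    have "upper E (1 - \<epsilon>)"
    proof (rule upper_of_eve_pot[where S = "X - R" and p = "\<lambda>x. p1 x + \<epsilon> * p2 x"])
      show "upper (X - R) (1 - \<epsilon>)" using upper_mono[OF S \<epsilon>(3)] .
      fix x A assume xA: "x \<in> E" "A \<in> opts x"
      obtain y d e where yde: "(y, d, e) \<in> A" "y \<in> X - R \<or> (y \<in> E \<and> p y \<le> p x + ?W d e)"
        using p[OF xA] by blast
      have "p1 y + \<epsilon> * p2 y \<le> p1 x + \<epsilon> * p2 x + (of_int e - (1 - \<epsilon>) * of_int d)" if "p y \<le> p x + ?W d e"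
        using that unfolding plt
      proof
        assume "p1 y < p1 x + (of_int e - of_int d)"
        then have "\<delta> \<le> p1 x + (of_int e - of_int d) - p1 y" using \<delta>(2)[OF xA yde(1)] by simp
        moreover have "\<epsilon> * (p2 y - p2 x - of_int d) \<le> \<epsilon> * c"
          using c[OF xA yde(1)] \<epsilon>(1) by (simp add: mult_left_mono)
        ultimately show ?thesis using \<epsilon>c by (simp add: algebra_simps)
      next
        assume *: "p1 y = p1 x + (of_int e - of_int d) \<and> p2 y \<le> p2 x + of_int d"
        then have "\<epsilon> * p2 y \<le> \<epsilon> * (p2 x + of_int d)" using \<epsilon>(1) by (simp add: mult_left_mono)
        then show ?thesis using * by (simp add: algebra_simps)
      qed
      then show "\<exists>(y, d, e)\<in>A. y \<in> X - R \<or> (y \<in> E \<and>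
          p1 y + \<epsilon> * p2 y \<le> p1 x + \<epsilon> * p2 x + (of_int e - (1 - \<epsilon>) * of_int d))"
        using yde by blast
    qed (use EX \<epsilon> in auto)
    moreover have "lower R (1 - \<epsilon> / 2)" using low \<epsilon>(1) by simp
    ultimately show False using upper_lower_contra[of x0 E "1 - \<epsilon>" R "1 - \<epsilon> / 2"] x0 E \<epsilon>(1) by auto
  qed
  obtain \<delta>1 where \<delta>1: "0 < \<delta>1" "\<And>x A y d e. x \<in> R \<Longrightarrow> A \<in> opts x \<Longrightarrow> (y, d, e) \<in> A \<Longrightarrow>
        0 < q1 x - (of_int e - of_int d + q1 y) \<Longrightarrow> \<delta>1 \<le> q1 x - (of_int e - of_int d + q1 y)"
    using edge_slack[OF R, of "\<lambda>x y d e. q1 x - (of_int e - of_int d + q1 y)"] by blast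
  obtain \<delta>2 where \<delta>2: "0 < \<delta>2" "\<And>x A y d e. x \<in> R \<Longrightarrow> A \<in> opts x \<Longrightarrow> (y, d, e) \<in> A \<Longrightarrow>
        0 < q2 x - (of_int d + q2 y) \<Longrightarrow> \<delta>2 \<le> q2 x - (of_int d + q2 y)"
    using edge_slack[OF R, of "\<lambda>x y d e. q2 x - (of_int d + q2 y)"] by blast
  let ?D = "(\<Union>x\<in>R. \<Union>A\<in>opts x. (\<lambda>(y, d, e). of_int d + q2 y - q2 x) ` A)"
  obtain c where "\<forall>a\<in>?D. a \<le> c"
    using finite_upper[OF finite_edges[OF R, of "\<lambda>x y d e. of_int d + q2 y - q2 x"]] by blast
  then have c: "of_int d + q2 y - q2 x \<le> c" if "x \<in> R" "A \<in> opts x" "(y, d, e) \<in> A" for x A y d e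
    using that by force
  \<comment> \<open>Chosen so that \<open>q1 + \<epsilon> q2\<close> drops by
    \<open>\<epsilon> \<delta>2\<close> for slope \<open>1 - \<epsilon>\<close> in both cases: a
    first-component slack of \<open>\<delta>1\<close> outweighs the largest loss in the second, and
    on ties the second itself drops by \<open>\<delta>2\<close>. For slope 1 the component
    \<open>q1\<close> suffices.\<close>
  define \<epsilon> where "\<epsilon> = \<delta>1 / (\<bar>c\<bar> + \<delta>2 + 1)"
  have \<epsilon>: "0 < \<epsilon>" using \<delta>1(1) \<delta>2(1) by (auto simp: \<epsilon>_def)
  have "\<epsilon> * (\<bar>c\<bar> + \<delta>2 + 1) = \<delta>1" using \<delta>2(1) by (simp add: \<epsilon>_def)
  then have \<epsilon>c: "\<epsilon> * c + \<epsilon> * \<delta>2 \<le> \<delta>1"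
    using \<epsilon> mult_left_mono[of "c + \<delta>2" "\<bar>c\<bar> + \<delta>2 + 1" \<epsilon>] by (simp add: distrib_left)
  show "lower R 1"
  proof (rule lower_of_adam_pot[where \<phi> = "1 - \<epsilon>" and \<delta> = "\<epsilon> * \<delta>2" and q = q1 and r = "\<lambda>x. q1 x + \<epsilon> * q2 x"])
    show "lower R (1 - \<epsilon>)" using low \<epsilon> by simp
    show "0 < \<epsilon> * \<delta>2" using \<epsilon> \<delta>2(1) by simp
    fix x assume x: "x \<in> R"
    then obtain B where B: "B \<in> opts x" "\<forall>(y, d, e)\<in>B. y \<in> R \<and> ?W d e + q y < q x"
      using q \<open>E = {}\<close> by auto
    have main: "case z of (y, d, e) \<Rightarrow> y \<in> R \<and> of_int e - 1 * of_int d + q1 y \<le> q1 x \<and>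
        of_int e - (1 - \<epsilon>) * of_int d + (q1 y + \<epsilon> * q2 y) \<le> q1 x + \<epsilon> * q2 x - \<epsilon> * \<delta>2"
      if "z \<in> B" for z
    proof (cases z)
      case (fields y d e)
      then have yde: "(y, d, e) \<in> B" using that by simp
      have y: "y \<in> R" "?W d e + q y < q x" using B(2) yde by auto
      from y(2) show ?thesis unfolding qlt
      proof
        assume *: "of_int e - of_int d + q1 y < q1 x"
        then have "\<delta>1 \<le> q1 x - (of_int e - of_int d + q1 y)" using \<delta>1(2)[OF x B(1) yde] by simp
        moreover have "\<epsilon> * (of_int d + q2 y - q2 x) \<le> \<epsilon> * c"
          using c[OF x B(1) yde] \<epsilon> by (simp add: mult_left_mono)
        ultimately show ?thesis using y(1) * \<epsilon>c unfolding fields by (simp add: algebra_simps)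
      next
        assume *: "of_int e - of_int d + q1 y = q1 x \<and> of_int d + q2 y < q2 x"
        then have "\<delta>2 \<le> q2 x - (of_int d + q2 y)" using \<delta>2(2)[OF x B(1) yde] by simp
        then have "\<epsilon> * \<delta>2 \<le> \<epsilon> * (q2 x - (of_int d + q2 y))" using \<epsilon> by (simp add: mult_left_mono)
        then show ?thesis using y(1) * unfolding fields by (simp add: algebra_simps)
      qed
    qed
    show "\<exists>B\<in>opts x. \<forall>(y, d, e)\<in>B. y \<in> R \<and> of_int e - 1 * of_int d + q1 y \<le> q1 x \<and>
        of_int e - (1 - \<epsilon>) * of_int d + (q1 y + \<epsilon> * q2 y) \<le> q1 x + \<epsilon> * q2 x - \<epsilon> * \<delta>2"
      by (intro bexI[OF _ B(1)] ballI main)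
  qed (rule R)
qed

text \<open>After the slopes below 1, one more peeling at slope exactly 1 separates \<open>Z\<close>
  from \<open>T\<close>. The two bounds on \<open>Z\<close> confine its threshold to a belt around
  the diagonal.\<close>

theorem belts:
  obtains S Z T \<theta> \<delta> where "X = S \<union> Z \<union> T" "\<theta> < 1" "upper S \<theta>" "upper Z 1" "lower Z 1"
    "0 < \<delta>" "lower T (1 + \<delta>)"
proof -
  obtain S \<theta> where S: "S \<subseteq> X" "\<theta> < 1" "upper S \<theta>" "\<And>\<phi>. \<phi> < 1 \<Longrightarrow> lower (X - S) \<phi>"
    using steep_part by blast
  have XS: "X - (X - S) = S" using S(1) by blast
  have "upper (X - (X - S)) 1" using upper_mono[OF S(3), of 1] S(2) XS by simp
  then obtain Z \<delta> where Z: "Z \<subseteq> X - S" "upper Z 1" "0 < \<delta>" "lower (X - S - Z) (1 + \<delta>)"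
    by (rule peel[OF Diff_subset zero_le_one _ S(4)])
  have "lower Z 1" using lower_1[of "X - S" \<theta>] S XS lower_mono[of "X - S" 1 1 Z] Z(1) by auto
  then show thesis using that[of S Z "X - S - Z" \<theta> \<delta>] S Z by blast
qed

end

section \<open>Periodicity along diagonals\<close>

context counter_game
begin

lemma upper_eventually:
  assumes "upper S \<theta>" "\<theta> < 1"
  shows "\<exists>M\<ge>0. \<forall>x\<in>S. \<forall>m\<ge>M. H x m (m + k)"
proof -
  obtain C where C: "\<And>x m h. x \<in> S \<Longrightarrow> 0 \<le> m \<Longrightarrow> \<theta> * of_int m + C \<le> of_int h \<Longrightarrow> H x m h"
    using assms(1) unfolding upper_def by blast
  define M where "M = max 0 \<lceil>(C - of_int k) / (1 - \<theta>)\<rceil>"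
  have "H x m (m + k)" if "x \<in> S" "m \<ge> M" for x m
  proof (rule C)
    have "(C - of_int k) / (1 - \<theta>) \<le> of_int m" using that(2) unfolding M_def by linarith
    then show "\<theta> * of_int m + C \<le> of_int (m + k)" using assms(2) by (simp add: field_simps)
  qed (use that in \<open>auto simp: M_def\<close>)
  then show ?thesis by (intro exI[of _ M]) (auto simp: M_def)
qed

lemma lower_eventually:
  assumes "lower T (1 + \<delta>)" "0 < \<delta>"
  shows "\<exists>M\<ge>0. \<forall>x\<in>T. \<forall>m\<ge>M. \<not> H x m (m + k)"
proof -
  obtain C where C: "\<And>x m h. x \<in> T \<Longrightarrow> 0 \<le> m \<Longrightarrow> H x m h \<Longrightarrow> (1 + \<delta>) * of_int m - C \<le> of_int h"
    using assms(1) unfolding lower_def by blast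
  define M where "M = max 0 (\<lceil>(C + of_int k) / \<delta>\<rceil> + 1)"
  have "\<not> H x m (m + k)" if "x \<in> T" "m \<ge> M" for x m
  proof
    assume "H x m (m + k)"
    then have "(1 + \<delta>) * of_int m - C \<le> of_int (m + k)"
      by (rule C[OF that(1), rotated]) (use that(2) in \<open>simp add: M_def\<close>)
    moreover have "(C + of_int k) / \<delta> < of_int m" using that(2) unfolding M_def by linarith
    ultimately show False using assms(2) by (simp add: field_simps)
  qed
  then show ?thesis by (intro exI[of _ M]) (auto simp: M_def)
qed

text \<open>Translation by \<open>m2 - m1\<close> preserves Eve's wins in \<open>Z\<close> by
  coinduction. Inside the belt a move into \<open>S\<close> wins, a winning reply never enters
  \<open>T\<close>, and a move within \<open>Z\<close> continues the translated play. The offset 2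
  in \<open>S\<close> and \<open>T\<close> is the largest change of \<open>h - m\<close> in one
  round.\<close>

lemma shift:
  assumes X: "X = S \<union> Z \<union> T"
    and up: "\<And>x m h. x \<in> Z \<Longrightarrow> 0 \<le> m \<Longrightarrow> m + C \<le> h \<Longrightarrow> H x m h"
    and lo: "\<And>x m h. x \<in> Z \<Longrightarrow> 0 \<le> m \<Longrightarrow> H x m h \<Longrightarrow> m - C \<le> h"
    and S: "\<And>x m. x \<in> S \<Longrightarrow> M \<le> m \<Longrightarrow> H x m (m - C - 2)"
    and T: "\<And>x m. x \<in> T \<Longrightarrow> M \<le> m \<Longrightarrow> \<not> H x m (m + C + 2)"
    and M: "0 \<le> M" "C \<le> M"
    and m: "M \<le> m1" "M \<le> m2"
    and agree: "\<And>x k. x \<in> Z \<Longrightarrow> H x m1 (m1 + k) \<Longrightarrow> H x m2 (m2 + k)"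
    and x: "x \<in> Z" "0 \<le> j" "H x (m1 + j) (m1 + j + k)"
  shows "H x (m2 + j) (m2 + j + k)"
proof -
  define K where "K x m h \<longleftrightarrow> x \<in> Z \<and> m2 \<le> m \<and> H x (m - m2 + m1) (h - m2 + m1)" for x m h
  have "K x (m2 + j) (m2 + j + k)" unfolding K_def using x by (simp add: algebra_simps)
  then show ?thesis
  proof (rule coind[of K, rotated])
    fix x m h assume K: "K x m h"
    then have x: "x \<in> Z" "x \<in> X" and m': "m2 \<le> m" and H1: "H x (m - m2 + m1) (h - m2 + m1)"
      using X by (auto simp: K_def)
    have "m - m2 + m1 - C \<le> h - m2 + m1" using lo[OF x(1) _ H1] m m' M by simp
    then have h: "m - C \<le> h" by simp
    have "H x m h \<or> (1 \<le> m \<and> (\<forall>A\<in>opts x. \<exists>(y, d, e)\<in>A. K y (m + d) (h + e) \<or> H y (m + d) (h + e)))"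
    proof (cases "m + C \<le> h \<or> m = m2")
      \<comment> \<open>The translated play stops above the belt, where Eve wins outright, or in
        column \<open>m2\<close>, where \<open>agree\<close> applies.\<close>
      case True
      then show ?thesis
        using up[OF x(1), of m h] agree[OF x(1), of "h - m2"] H1 m m' M by (auto simp: algebra_simps)
    next
      case False
      then have "\<exists>(y, d, e)\<in>A. K y (m + d) (h + e) \<or> H y (m + d) (h + e)" if A: "A \<in> opts x" for A
      proof -
        have "1 \<le> m - m2 + m1" using False m m' M by auto
        from rule[OF x(2) this H1 A] obtain y d e where yde: "(y, d, e) \<in> A"
          and H2: "H y (m - m2 + m1 + d) (h - m2 + m1 + e)" by blast
        have y: "y \<in> X" "d \<in> {-1, 0, 1}" "e \<in> {-1, 0, 1}" using edge[OF x(2) A yde] by auto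
        have md: "M \<le> m + d" "M \<le> m - m2 + m1 + d" "m2 \<le> m + d" using False m m' y(2) by auto
        have "K y (m + d) (h + e) \<or> H y (m + d) (h + e)"
        proof -
          consider "y \<in> S" | "y \<in> Z" | "y \<in> T" using y(1) X by blast
          then show ?thesis
          proof cases
            case 1
            have "m + d - C - 2 \<le> h + e" using h y by auto
            then show ?thesis using mono[OF S[OF 1 md(1)]] by blast
          next
            case 2
            then show ?thesis unfolding K_def using H2 md(3) by (simp add: algebra_simps)
          next
            case 3
            have "h - m2 + m1 + e \<le> m - m2 + m1 + d + C + 2" using False y by auto
            then show ?thesis using T[OF 3 md(2)] mono[OF H2] by blast
          qed
        qed
        then show ?thesis using yde by blast
      qed
      moreover have "1 \<le> m" using False m m' M by auto
      ultimately show ?thesis by blast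
    qed
    then show "x \<in> X \<and> 0 \<le> m \<and> 0 \<le> h \<and>
        (H x m h \<or> 1 \<le> m \<and> (\<forall>A\<in>opts x. \<exists>(y, d, e)\<in>A. K y (m + d) (h + e) \<or> H y (m + d) (h + e)))"
      using x m' m M h by simp
  qed
qed

text \<open>For slopes below or above 1 the diagonal is eventually constant. In the belt finitely
  many bits describe a column, so two columns coincide; shifting from either to the other makes
  their distance a period.\<close>

theorem diagonal_periodic:
  assumes x: "x \<in> X"
  shows "\<exists>M P. 0 \<le> M \<and> 0 < P \<and> (\<forall>m\<ge>M. H x (m + P) (m + P + k) \<longleftrightarrow> H x m (m + k))"
proof -
  obtain S Z T \<theta> \<delta> where X: "X = S \<union> Z \<union> T" and S: "\<theta> < 1" "upper S \<theta>"
    and Z: "upper Z 1" "lower Z 1" and T: "0 < \<delta>" "lower T (1 + \<delta>)"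
    using belts by blast
  consider "x \<in> S" | "x \<in> Z" | "x \<in> T" using x X by blast
  then show ?thesis
  proof cases
    case 1
    obtain M where "0 \<le> M" "\<And>m. m \<ge> M \<Longrightarrow> H x m (m + k)" using upper_eventually[OF S(2,1), of k] 1 by blast
    then show ?thesis by (intro exI[of _ M] exI[of _ 1]) auto
  next
    case 3
    obtain M where "0 \<le> M" "\<And>m. m \<ge> M \<Longrightarrow> \<not> H x m (m + k)" using lower_eventually[OF T(2,1), of k] 3 by blast
    then show ?thesis by (intro exI[of _ M] exI[of _ 1]) auto
  next
    case 2
    obtain C1 where C1: "\<And>x m h. x \<in> Z \<Longrightarrow> 0 \<le> m \<Longrightarrow> 1 * real_of_int m + C1 \<le> of_int h \<Longrightarrow> H x m h"
      using Z(1) unfolding upper_def by blast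
    obtain C2 where C2: "\<And>x m h. x \<in> Z \<Longrightarrow> 0 \<le> m \<Longrightarrow> H x m h \<Longrightarrow> 1 * real_of_int m - C2 \<le> of_int h"
      using Z(2) unfolding lower_def by blast
    define C where "C = \<lceil>\<bar>C1\<bar> + \<bar>C2\<bar>\<rceil>"
    have up: "H x m h" if "x \<in> Z" "0 \<le> m" "m + C \<le> h" for x m h
    proof (rule C1[OF that(1,2)])
      show "1 * real_of_int m + C1 \<le> of_int h" using that(3) unfolding C_def by linarith
    qed
    have lo: "m - C \<le> h" if "x \<in> Z" "0 \<le> m" "H x m h" for x m h
      using C2[OF that] unfolding C_def by linarith
    obtain MS where MS: "\<And>x m. x \<in> S \<Longrightarrow> MS \<le> m \<Longrightarrow> H x m (m + (- C - 2))"
      using upper_eventually[OF S(2,1), of "- C - 2"] by blast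
    obtain MT where MT: "\<And>x m. x \<in> T \<Longrightarrow> MT \<le> m \<Longrightarrow> \<not> H x m (m + (C + 2))"
      using lower_eventually[OF T(2,1), of "C + 2"] by blast
    define M where "M = max (max 0 C) (max MS MT)"
    have MS': "H x m (m - C - 2)" if "x \<in> S" "M \<le> m" for x m
      using MS[OF that(1), of m] that(2) by (simp add: M_def algebra_simps)
    have MT': "\<not> H x m (m + C + 2)" if "x \<in> T" "M \<le> m" for x m
      using MT[OF that(1), of m] that(2) by (simp add: M_def algebra_simps)
    \<comment> \<open>Only offsets within the belt are recorded; outside it the bounds
      \<open>up\<close> and \<open>lo\<close> decide the answer.\<close>
    define G where "G n = {(x, k). x \<in> Z \<and> k \<in> {- C..C} \<and> H x (M + int n) (M + int n + k)}" for n
    have "range G \<subseteq> Pow (Z \<times> {- C..C})" unfolding G_def by auto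
    moreover have "finite (Pow (Z \<times> {- C..C}))" using finite_X X by simp
    ultimately have "finite (range G)" using finite_subset by blast
    then have "\<not> inj G" using finite_imageD[of G UNIV] by auto
    then obtain n1 n2 where "G n1 = G n2" "n1 \<noteq> n2" by (auto simp: inj_def)
    then obtain n1 n2 where n: "G n1 = G n2" "n1 < n2" by (metis nat_neq_iff)
    define m1 where "m1 = M + int n1"
    define m2 where "m2 = M + int n2"
    have m: "M \<le> m1" "m1 < m2" "0 \<le> M" "C \<le> M" using n by (auto simp: m1_def m2_def M_def)
    have agree: "H x m1 (m1 + k) \<longleftrightarrow> H x m2 (m2 + k)" if "x \<in> Z" for x k
    proof -
      consider "k < - C" | "C < k" | "k \<in> {- C..C}" by fastforce
      then show ?thesis
      proof cases
        case 1
        then show ?thesis using lo[OF that, of m1 "m1 + k"] lo[OF that, of m2 "m2 + k"] m by auto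
      next
        case 2
        then show ?thesis using up[OF that, of m1 "m1 + k"] up[OF that, of m2 "m2 + k"] m by auto
      next
        case 3
        then have "H x (M + int n) (M + int n + k) \<longleftrightarrow> (x, k) \<in> G n" for n using that by (simp add: G_def)
        then show ?thesis using n(1) by (simp add: m1_def m2_def)
      qed
    qed
    have m2: "M \<le> m2" using m by simp
    have agree1: "H x m1 (m1 + k) \<Longrightarrow> H x m2 (m2 + k)" and agree2: "H x m2 (m2 + k) \<Longrightarrow> H x m1 (m1 + k)"
      if "x \<in> Z" for x k using agree[OF that] by auto
    have "H x (m + (m2 - m1)) (m + (m2 - m1) + k) \<longleftrightarrow> H x m (m + k)" if "m1 \<le> m" for m
    proof -
      have j: "0 \<le> m - m1" using that by simp
      have "H x (m1 + (m - m1)) (m1 + (m - m1) + k) \<longleftrightarrow> H x (m2 + (m - m1)) (m2 + (m - m1) + k)"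
      proof
        assume *: "H x (m1 + (m - m1)) (m1 + (m - m1) + k)"
        show "H x (m2 + (m - m1)) (m2 + (m - m1) + k)"
          by (rule shift[of S Z T C M m1 m2 x "m - m1" k]) (fact X up lo MS' MT' m(3,4,1) m2 agree1 2 j *)+
      next
        assume *: "H x (m2 + (m - m1)) (m2 + (m - m1) + k)"
        show "H x (m1 + (m - m1)) (m1 + (m - m1) + k)"
          by (rule shift[of S Z T C M m2 m1 x "m - m1" k]) (fact X up lo MS' MT' m(3,4,1) m2 agree2 2 j *)+
      qed
      then show ?thesis by (simp add: algebra_simps)
    qed
    then show ?thesis using m by (intro exI[of _ m1] exI[of _ "m2 - m1"]) auto
  qed
qed

end

section \<open>Common periods of finitely many functions\<close>

lemma period_multiple:
  assumes "\<And>n. M \<le> n \<Longrightarrow> f (n + P) = f (n :: nat)" "M \<le> n"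
  shows "f (n + c * P) = f n"
proof (induction c)
  case (Suc c)
  then show ?case using assms(1)[of "n + c * P"] assms(2) by (simp add: algebra_simps)
qed simp

lemma common_period:
  assumes "finite I" "\<And>i. i \<in> I \<Longrightarrow> \<exists>M P. 0 < P \<and> (\<forall>n\<ge>M. f i (n + P) = f i (n :: nat))"
  shows "\<exists>M P. 0 < P \<and> (\<forall>i\<in>I. \<forall>n\<ge>M. f i (n + P) = f i n)"
  using assms
proof (induction I rule: finite_induct)
  case empty
  show ?case by (intro exI[of _ 0] exI[of _ 1]) simp
next
  case (insert i I)
  obtain M P where P: "0 < P" "\<forall>i\<in>I. \<forall>n\<ge>M. f i (n + P) = f i n" using insert by blast
  obtain M' P' where P': "0 < P'" "\<forall>n\<ge>M'. f i (n + P') = f i n" using insert.prems by blast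
  have "f j (n + P * P') = f j n" if "j \<in> insert i I" "max M M' \<le> n" for j n
  proof (cases "j = i")
    case True
    then show ?thesis using period_multiple[of M' "f i" P' n P] P' that by simp
  next
    case False
    then show ?thesis using period_multiple[of M "f j" P n P'] P that by (simp add: mult.commute)
  qed
  then show ?case using P(1) P'(1) by (intro exI[of _ "max M M'"] exI[of _ "P * P'"]) auto
qed

section \<open>Simulation between configurations\<close>

definition alive :: "('q, 'a) ocn \<Rightarrow> 'q \<times> nat \<Rightarrow> bool" where
  "alive N c \<longleftrightarrow> (\<exists>w c'. ocn_run N c w c' \<and> fst c' \<in> ocn_final N)"

text \<open>Only successors that can reach acceptance must be matched, since a winning strategy of Eve is
  unconstrained outside the prefixes of the language.\<close>

definition simulation :: "('q, 'a) ocn \<Rightarrow> ('q \<times> nat \<Rightarrow> 'q \<times> nat \<Rightarrow> bool) \<Rightarrow> bool" where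
  "simulation N R \<longleftrightarrow> (\<forall>c c'. R c c' \<longrightarrow> (fst c \<in> ocn_final N \<longrightarrow> fst c' \<in> ocn_final N) \<and>
     (\<forall>a c1. ocn_step N c a c1 \<longrightarrow> alive N c1 \<longrightarrow> (\<exists>c1'. ocn_step N c' a c1' \<and> R c1 c1')))"

definition ocn_sim :: "('q, 'a) ocn \<Rightarrow> 'q \<times> nat \<Rightarrow> 'q \<times> nat \<Rightarrow> bool" where
  "ocn_sim N c c' \<longleftrightarrow> (\<exists>R. simulation N R \<and> R c c')"

lemma ocn_simD:
  assumes "ocn_sim N c c'"
  shows "fst c \<in> ocn_final N \<Longrightarrow> fst c' \<in> ocn_final N"
    and "ocn_step N c a c1 \<Longrightarrow> alive N c1 \<Longrightarrow> \<exists>c1'. ocn_step N c' a c1' \<and> ocn_sim N c1 c1'"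
proof -
  obtain R where R: "simulation N R" "R c c'" using assms unfolding ocn_sim_def by blast
  show "fst c \<in> ocn_final N \<Longrightarrow> fst c' \<in> ocn_final N" using R unfolding simulation_def by blast
  assume "ocn_step N c a c1" "alive N c1"
  then have "\<exists>c1'. ocn_step N c' a c1' \<and> R c1 c1'" using R unfolding simulation_def by blast
  then show "\<exists>c1'. ocn_step N c' a c1' \<and> ocn_sim N c1 c1'" using R(1) unfolding ocn_sim_def by blast
qed

lemma ocn_sim_coinduct [consumes 1, case_names ocn_sim, coinduct pred: ocn_sim]:
  assumes "R c c'"
    and step: "\<And>c c'. R c c' \<Longrightarrow> (fst c \<in> ocn_final N \<longrightarrow> fst c' \<in> ocn_final N) \<and>
     (\<forall>a c1. ocn_step N c a c1 \<longrightarrow> alive N c1 \<longrightarrow>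
       (\<exists>c1'. ocn_step N c' a c1' \<and> (R c1 c1' \<or> ocn_sim N c1 c1')))"
  shows "ocn_sim N c c'"
proof -
  let ?S = "\<lambda>c c'. R c c' \<or> ocn_sim N c c'"
  have "(fst c \<in> ocn_final N \<longrightarrow> fst c' \<in> ocn_final N) \<and>
     (\<forall>a c1. ocn_step N c a c1 \<longrightarrow> alive N c1 \<longrightarrow> (\<exists>c1'. ocn_step N c' a c1' \<and> ?S c1 c1'))"
    if "?S c c'" for c c'
    using that
  proof
    assume "R c c'"
    then show ?thesis by (rule step)
  next
    assume "ocn_sim N c c'"
    then show ?thesis using ocn_simD[of N c c'] by blast
  qed
  then have "simulation N ?S" unfolding simulation_def by blast
  then show ?thesis using assms(1) unfolding ocn_sim_def by blast
qed

section \<open>Runs, aliveness and monotonicity in the counter\<close>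

lemma ocn_run_Cons_iff: "ocn_run N c (a # w) c'' \<longleftrightarrow> (\<exists>c'. ocn_step N c a c' \<and> ocn_run N c' w c'')"
  by (subst ocn_run.simps) blast

lemma ocn_run_Nil_iff: "ocn_run N c [] c'' \<longleftrightarrow> c'' = c"
  by (subst ocn_run.simps) blast

lemma ocn_run_append: "ocn_run N c (u @ v) c'' \<longleftrightarrow> (\<exists>c'. ocn_run N c u c' \<and> ocn_run N c' v c'')"
  by (induction u arbitrary: c) (auto simp: ocn_run_Cons_iff ocn_run_Nil_iff)

lemma ocn_run_snoc: "ocn_run N c (w @ [a]) c'' \<longleftrightarrow> (\<exists>c'. ocn_run N c w c' \<and> ocn_step N c' a c'')"
  unfolding ocn_run_append ocn_run_Cons_iff ocn_run_Nil_iff by blast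

lemma alive_final: "fst c \<in> ocn_final N \<Longrightarrow> alive N c"
  unfolding alive_def by (intro exI conjI) (rule ocn_run_nil)

lemma alive_step: "ocn_step N c a c' \<Longrightarrow> alive N c' \<Longrightarrow> alive N c"
  unfolding alive_def by (elim exE conjE, intro exI conjI) (rule ocn_run_cons)

lemma alive_run: "ocn_run N c w c' \<Longrightarrow> alive N c' \<Longrightarrow> alive N c"
  by (induction rule: ocn_run.induct) (auto intro: alive_step)

text \<open>Every configuration on an accepting run is alive, so restricting the matching to alive
  successors still gives language inclusion.\<close>

lemma ocn_sim_run:
  assumes "ocn_run N c w c1" "fst c1 \<in> ocn_final N" "ocn_sim N c c'"
  shows "\<exists>c1'. ocn_run N c' w c1' \<and> fst c1' \<in> ocn_final N"
  using assms
proof (induction arbitrary: c' rule: ocn_run.induct)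
  case (ocn_run_nil c)
  then show ?case using ocn_simD(1)[of N c c'] ocn_run.ocn_run_nil by blast
next
  case (ocn_run_cons c a c2 w c3)
  have "alive N c2" using ocn_run_cons alive_run alive_final by blast
  then obtain c2' where c2': "ocn_step N c' a c2'" "ocn_sim N c2 c2'"
    using ocn_simD(2)[OF ocn_run_cons.prems(2) ocn_run_cons.hyps(1)] by blast
  show ?case using ocn_run_cons.IH[OF ocn_run_cons.prems(1) c2'(2)] c2'(1) ocn_run_Cons_iff by metis
qed

lemma ocn_sim_alive: "ocn_sim N c c' \<Longrightarrow> alive N c \<Longrightarrow> alive N c'"
  unfolding alive_def by (elim exE conjE, drule (2) ocn_sim_run) blast

text \<open>The middle step must also lead to an alive configuration before the second simulation
  has to match it; this holds because simulation preserves aliveness.\<close>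

lemma ocn_sim_trans:
  assumes "ocn_sim N c c'" "ocn_sim N c' c''"
  shows "ocn_sim N c c''"
proof -
  have "\<exists>c'. ocn_sim N c c' \<and> ocn_sim N c' c''" using assms by blast
  then show ?thesis
  proof (coinduction arbitrary: c c'')
    case (ocn_sim c c'')
    then obtain c' where s: "ocn_sim N c c'" "ocn_sim N c' c''" by blast
    show ?case
    proof (intro conjI allI impI)
      show "fst c'' \<in> ocn_final N" if "fst c \<in> ocn_final N"
        using ocn_simD(1)[OF s(2) ocn_simD(1)[OF s(1) that]] .
      fix a c1 assume c1: "ocn_step N c a c1" "alive N c1"
      obtain c1' where c1': "ocn_step N c' a c1'" "ocn_sim N c1 c1'" using ocn_simD(2)[OF s(1) c1] by blast
      obtain c1'' where "ocn_step N c'' a c1''" "ocn_sim N c1' c1''"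
        using ocn_simD(2)[OF s(2) c1'(1)] ocn_sim_alive[OF c1'(2) c1(2)] by blast
      then show "\<exists>c1''. ocn_step N c'' a c1'' \<and> ((\<exists>c c''. c1 = c \<and> c1'' = c'' \<and>
          (\<exists>c'. ocn_sim N c c' \<and> ocn_sim N c' c'')) \<or> ocn_sim N c1 c1'')"
        using c1'(2) by (intro exI[of _ c1'']) blast
    qed
  qed
qed

lemma ocn_step_mono:
  assumes "ocn_step N (p, m) a (p1, m1)" "m \<le> m'"
  shows "ocn_step N (p, m') a (p1, m1 + (m' - m))"
proof -
  obtain d where d: "(p, a, d, p1) \<in> ocn_delta N" "0 \<le> int m + d" "m1 = nat (int m + d)"
    using assms(1) by (auto simp: ocn_step_def)
  then show ?thesis using assms(2) unfolding ocn_step_def by (intro exI[of _ d]) auto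
qed

text \<open>A net has no zero tests, so the configuration with the larger counter copies every step
  and keeps its surplus.\<close>

lemma ocn_sim_mono:
  assumes "m \<le> m'"
  shows "ocn_sim N (p, m) (p, m')"
proof -
  have "ocn_sim N c c'" if "\<exists>p m m'. c = (p, m) \<and> c' = (p, m') \<and> m \<le> m'" for c c'
    using that
  proof (coinduction arbitrary: c c')
    case (ocn_sim c c')
    then obtain p m m' where c: "c = (p, m)" "c' = (p, m')" "m \<le> m'" by blast
    have "\<exists>c1'. ocn_step N c' a c1' \<and> (\<exists>p m m'. c1 = (p, m) \<and> c1' = (p, m') \<and> m \<le> m')"
      if "ocn_step N c a c1" for a c1
    proof -
      obtain p1 m1 where c1: "c1 = (p1, m1)" by fastforce
      then have "ocn_step N c' a (p1, m1 + (m' - m))" using ocn_step_mono that c by simp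
      then show ?thesis using c1 by (intro exI[of _ "(p1, m1 + (m' - m))"]) auto
    qed
    then show ?case using c by (auto simp del: split_paired_Ex split_paired_All) blast
  qed
  then show ?thesis using assms by blast
qed

lemma ocn_sim_antimono:
  "ocn_sim N (p, m) (p', h) \<Longrightarrow> m' \<le> m \<Longrightarrow> h \<le> h' \<Longrightarrow> ocn_sim N (p, m') (p', h')"
  by (rule ocn_sim_trans[OF ocn_sim_mono ocn_sim_trans[OF _ ocn_sim_mono]])

lemma alive_mono: "alive N (p, m) \<Longrightarrow> m \<le> m' \<Longrightarrow> alive N (p, m')"
  by (rule ocn_sim_alive[OF ocn_sim_mono])

text \<open>The simulation game is presented as a game on two counters. Adam's counter is offset by
  \<open>B\<close>, above which aliveness depends on the state alone, so that his options are the
  same in all columns.\<close>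

lemma ocn_sim_diagonal_periodic:
  fixes N :: "('q, 'a) ocn"
  assumes wf: "wf_ocn N" and Q: "p' \<in> ocn_states N" "p \<in> ocn_states N"
  shows "\<exists>M P. 0 < P \<and> (\<forall>m\<ge>M. ocn_sim N (p', m + P) (p, nat (int (m + P) + k)) \<longleftrightarrow> ocn_sim N (p', m) (p, nat (int m + k)))"
proof -
  let ?Q = "ocn_states N" and ?F = "ocn_final N" and ?\<Delta> = "ocn_delta N"
  have fin: "finite ?Q" "finite (ocn_alph N)" and delta: "?\<Delta> \<subseteq> ?Q \<times> ocn_alph N \<times> {-1, 0, 1} \<times> ?Q"
    using wf by (auto simp: wf_ocn_def)
  have fin\<Delta>: "finite ?\<Delta>" by (rule finite_subset[OF delta]) (use fin in auto)
  define AL where "AL = {p. \<exists>m. alive N (p, m)}"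
  have "\<forall>p\<in>AL. \<exists>m. alive N (p, m)" unfolding AL_def by blast
  then obtain f where f: "\<And>p. p \<in> AL \<Longrightarrow> alive N (p, f p)" by metis
  obtain B where fB: "\<forall>a\<in>f ` ?Q. a \<le> B" using finite_upper[of "f ` ?Q"] fin by auto
  have B: "alive N (p, m) \<longleftrightarrow> p \<in> AL" if "p \<in> ?Q" "B \<le> m" for p m
  proof
    show "p \<in> AL" if "alive N (p, m)" using that by (auto simp: AL_def)
    show "alive N (p, m)" if "p \<in> AL"
      using alive_mono[OF f[OF that], of m] \<open>p \<in> ?Q\<close> \<open>B \<le> m\<close> fB by auto
  qed
  define H :: "'q \<times> 'q \<Rightarrow> int \<Rightarrow> int \<Rightarrow> bool" where "H x m h \<longleftrightarrow> 0 \<le> h \<and> ocn_sim N (fst x, B + nat m) (snd x, nat h)" for x m h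
  define X where "X = {x \<in> ?Q \<times> ?Q. \<exists>h. H x 0 h}"
  define succs :: "'q \<times> 'q \<Rightarrow> 'a \<times> int \<times> 'q \<Rightarrow> (('q \<times> 'q) \<times> int \<times> int) set" where "succs x t = (case t of (a, d, p1) \<Rightarrow>
      {((p1, p2), d, e) | p2 e. (snd x, a, e, p2) \<in> ?\<Delta> \<and> (p1, p2) \<in> X})" for x t
  define moves :: "'q \<times> 'q \<Rightarrow> ('a \<times> int \<times> 'q) set" where "moves x = {(a, d, p1). (fst x, a, d, p1) \<in> ?\<Delta> \<and> p1 \<in> AL}" for x
  \<comment> \<open>Each alive move of Adam is an option consisting of Eve's replies. The empty
    option encodes her immediate loss when only Adam's state is final.\<close>
  define opts where "opts x = (if fst x \<in> ?F \<and> snd x \<notin> ?F then {{}} else {}) \<union> succs x ` moves x" for x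
  have H0: "H x 0 h" if "H x m h" "0 \<le> m" for x m h
    using that ocn_sim_antimono[of N "fst x" "B + nat m" "snd x" "nat h" B "nat h"] by (auto simp: H_def)
  interpret counter_game X opts H
  proof
    show "finite X" unfolding X_def using fin by simp
    fix x assume x: "x \<in> X"
    have "moves x \<subseteq> (\<lambda>(q, t). t) ` ?\<Delta>" unfolding moves_def by force
    then have fm: "finite (moves x)" using fin\<Delta> finite_surj by blast
    then show "finite (opts x)" unfolding opts_def by simp
    show "finite A" if "A \<in> opts x" for A
    proof -
      have "succs x t \<subseteq> (\<lambda>(q, a, e, p2). ((snd (snd t), p2), fst (snd t), e)) ` ?\<Delta>" for t
        unfolding succs_def by (cases t) force
      then have "finite (succs x t)" for t by (rule finite_subset) (rule finite_imageI[OF fin\<Delta>])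
      then show ?thesis using that unfolding opts_def by (auto split: if_splits)
    qed
    show "\<exists>h. H x 0 h" using x by (simp add: X_def)
  next
    fix x A y d e assume "x \<in> X" "A \<in> opts x" "(y, d, e) \<in> A"
    then show "y \<in> X \<and> d \<in> {-1, 0, 1} \<and> e \<in> {-1, 0, 1}"
      using delta unfolding opts_def succs_def moves_def by (auto split: if_splits)
  next
    fix x m h assume "H x m h" then show "0 \<le> h" by (simp add: H_def)
  next
    fix x m h A assume x: "x \<in> X" and m: "1 \<le> m" and H: "H x m h" and A: "A \<in> opts x"
    obtain p' p where xp: "x = (p', p)" by fastforce
    have Q: "p' \<in> ?Q" "p \<in> ?Q" using x by (auto simp: xp X_def)
    have sim: "ocn_sim N (p', B + nat m) (p, nat h)" and h: "0 \<le> h" using H by (auto simp: H_def xp)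
    have "A \<noteq> {} \<or> A \<in> succs x ` moves x"
      using ocn_simD(1)[OF sim] A by (auto simp: opts_def xp split: if_splits)
    moreover have "A \<in> succs x ` moves x" if "A \<noteq> {}" using A that by (auto simp: opts_def split: if_splits)
    ultimately obtain a d p1 where A: "A = succs x (a, d, p1)" and t: "(p', a, d, p1) \<in> ?\<Delta>" "p1 \<in> AL"
      by (auto simp: moves_def xp)
    have d: "d \<in> {-1, 0, 1}" "p1 \<in> ?Q" using t delta by auto
    define m1 where "m1 = B + nat (m + d)"
    have step: "ocn_step N (p', B + nat m) a (p1, m1)"
      unfolding ocn_step_def m1_def using t d m by (auto intro!: exI[of _ d])
    have al: "alive N (p1, m1)" using B[OF d(2), of m1] t(2) by (simp add: m1_def)
    obtain p2 h1 where s: "ocn_step N (p, nat h) a (p2, h1)" "ocn_sim N (p1, m1) (p2, h1)"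
      using ocn_simD(2)[OF sim step al] by auto
    then obtain e where e: "(p, a, e, p2) \<in> ?\<Delta>" "0 \<le> h + e" "h1 = nat (h + e)"
      using h by (auto simp: ocn_step_def)
    have H': "H (p1, p2) (m + d) (h + e)" using s(2) e by (simp add: H_def m1_def)
    moreover have "(p1, p2) \<in> X" using H0[OF H'] d m e(1) delta unfolding X_def by auto
    ultimately show "\<exists>(y, d, e)\<in>A. H y (m + d) (h + e)"
      using e(1) unfolding A succs_def by (auto simp: xp)
  next
    fix K x m h
    assume K: "\<And>x m h. K x m h \<Longrightarrow> x \<in> X \<and> 0 \<le> m \<and> 0 \<le> h \<and> (H x m h \<or> 1 \<le> m \<and>
        (\<forall>A\<in>opts x. \<exists>(y, d, e)\<in>A. K y (m + d) (h + e) \<or> H y (m + d) (h + e)))" and K0: "K x m h"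
    have "ocn_sim N (fst x, B + nat m) (snd x, nat h)"
      using K0
    proof (coinduction arbitrary: x m h)
      case ocn_sim
      obtain p' p where xp: "x = (p', p)" by fastforce
      note Kx = K[OF ocn_sim]
      let ?R = "\<lambda>c1 c1'. (\<exists>x m h. c1 = (fst x, B + nat m) \<and> c1' = (snd x, nat h) \<and> K x m h) \<or> ocn_sim N c1 c1'"
      have "(p' \<in> ?F \<longrightarrow> p \<in> ?F) \<and> (\<forall>a c1. ocn_step N (p', B + nat m) a c1 \<longrightarrow> alive N c1 \<longrightarrow>
          (\<exists>c1'. ocn_step N (p, nat h) a c1' \<and> ?R c1 c1'))"
      proof (cases "H x m h")
        case True
        then show ?thesis using ocn_simD[of N "(p', B + nat m)" "(p, nat h)"] by (fastforce simp: H_def xp)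
      next
        case False
        then have m: "1 \<le> m" and opt: "\<And>A. A \<in> opts x \<Longrightarrow> \<exists>(y, d, e)\<in>A. K y (m + d) (h + e) \<or> H y (m + d) (h + e)"
          using Kx by auto
        have "p' \<in> ?F \<longrightarrow> p \<in> ?F"
        proof (rule ccontr)
          assume "\<not> (p' \<in> ?F \<longrightarrow> p \<in> ?F)"
          then have "{} \<in> opts x" by (simp add: opts_def xp)
          from opt[OF this] show False by simp
        qed
        moreover have "\<exists>c1'. ocn_step N (p, nat h) a c1' \<and> ?R c1 c1'"
          if step: "ocn_step N (p', B + nat m) a c1" and al1: "alive N c1" for a c1
        proof -
          obtain p1 d where c1: "c1 = (p1, nat (int (B + nat m) + d))" and t: "(p', a, d, p1) \<in> ?\<Delta>"
            using step by (cases c1) (auto simp: ocn_step_def)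
          have d: "d \<in> {-1, 0, 1}" "p1 \<in> ?Q" using t delta by auto
          have c1': "c1 = (p1, B + nat (m + d))" using c1 d m by auto
          have "p1 \<in> AL" using al1 c1 by (auto simp: AL_def)
          then have "succs x (a, d, p1) \<in> opts x" using t by (auto simp: opts_def moves_def xp)
          from opt[OF this] obtain p2 e where e: "(p, a, e, p2) \<in> ?\<Delta>"
            and KH: "K (p1, p2) (m + d) (h + e) \<or> H (p1, p2) (m + d) (h + e)"
            by (auto simp: succs_def xp)
          have he: "0 \<le> h + e" using KH K by (auto simp: H_def)
          have "ocn_step N (p, nat h) a (p2, nat (h + e))"
            unfolding ocn_step_def using e he Kx by (auto intro!: exI[of _ e])
          moreover have "?R c1 (p2, nat (h + e))" using KH by (force simp: c1' H_def)
          ultimately show ?thesis by blast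
        qed
        ultimately show ?thesis by blast
      qed
      then show ?case by (simp add: xp)
    qed
    then show "H x m h" using K[OF K0] by (simp add: H_def)
  next
    fix x m h h' assume "H x m h" "h \<le> (h'::int)"
    then show "H x m h'"
      using ocn_sim_antimono[of N "fst x" "B + nat m" "snd x" "nat h" "B + nat m" "nat h'"] by (auto simp: H_def)
  qed
  \<comment> \<open>Column \<open>m\<close> stands for Adam's counter value \<open>m + B\<close>, so
    an offset \<open>k\<close> between the counters becomes \<open>k + B\<close> in the
    game.\<close>
  let ?x = "(p', p)" and ?k = "k + int B"
  have "\<exists>M P. 0 \<le> M \<and> 0 < P \<and> (\<forall>m\<ge>M. H ?x (m + P) (m + P + ?k) \<longleftrightarrow> H ?x m (m + ?k))"
  proof (cases "?x \<in> X")
    case True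
    then show ?thesis by (rule diagonal_periodic)
  next
    case False
    then have "\<not> H ?x m h" if "0 \<le> m" for m h using H0[OF _ that] Q unfolding X_def by auto
    then show ?thesis by (intro exI[of _ 0] exI[of _ 1]) auto
  qed
  then obtain M P where M: "0 \<le> M" "0 < P" "\<And>m. m \<ge> M \<Longrightarrow> H ?x (m + P) (m + P + ?k) \<longleftrightarrow> H ?x m (m + ?k)" by blast
  \<comment> \<open>Beyond this bound the column \<open>m - B\<close> is at least \<open>M\<close>,
    and \<open>m + k\<close> is nonnegative, so \<open>nat\<close> loses nothing.\<close>
  define M1 where "M1 = B + nat M + nat \<bar>k\<bar>"
  have H: "H ?x (int m - int B) (int m - int B + ?k) \<longleftrightarrow> ocn_sim N (p', m) (p, nat (int m + k))" if "M1 \<le> m" for m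
  proof -
    have "B + nat (int m - int B) = m" "0 \<le> int m + k" using that by (auto simp: M1_def)
    then show ?thesis by (simp add: H_def add.commute)
  qed
  have "ocn_sim N (p', m + nat P) (p, nat (int (m + nat P) + k)) \<longleftrightarrow> ocn_sim N (p', m) (p, nat (int m + k))" if m: "M1 \<le> m" for m
  proof -
    have "M \<le> int m - int B" using m M(1) by (auto simp: M1_def)
    from M(3)[OF this] show ?thesis using H[OF m] H[of "m + nat P"] m M(2) by (simp add: algebra_simps)
  qed
  then show ?thesis using M(2) by (intro exI[of _ M1] exI[of _ "nat P"]) auto
qed

section \<open>The deterministic automaton\<close>

fun choice_run :: "(nat \<Rightarrow> 'q \<Rightarrow> 'a \<Rightarrow> (int \<times> 'q) option) \<Rightarrow> 'q \<times> nat \<Rightarrow> 'a list \<Rightarrow> ('q \<times> nat) option" where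
  "choice_run ch c [] = Some c"
| "choice_run ch c (a # w) =
     (case ch (snd c) (fst c) a of None \<Rightarrow> None | Some (d, p) \<Rightarrow> choice_run ch (p, nat (int (snd c) + d)) w)"

lemma choice_run_append:
  "choice_run ch c (u @ v) = (case choice_run ch c u of None \<Rightarrow> None | Some c' \<Rightarrow> choice_run ch c' v)"
  by (induction u arbitrary: c) (auto split: option.splits)

text \<open>The state of the automaton contains the counter value up to \<^term>\<open>M\<close> and modulo \<^term>\<open>P\<close> beyond, its
  counter the excess over \<^term>\<open>M\<close>.\<close>

lemma periodic_choice_oca:
  fixes ch :: "nat \<Rightarrow> 'q \<Rightarrow> 'a \<Rightarrow> (int \<times> 'q) option"
  assumes fin: "finite Q" "finite \<Sigma>" and q0: "q0 \<in> Q"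
    and ch: "\<And>n q a d p. ch n q a = Some (d, p) \<Longrightarrow> a \<in> \<Sigma> \<and> d \<in> {-1, 0, 1} \<and> p \<in> Q \<and> 0 \<le> int n + d"
    and P: "0 < P" "\<And>n. M \<le> n \<Longrightarrow> ch (n + P) = ch n"
  shows "\<exists>D :: (nat, 'a) oca. wf_oca D \<and> oca_alph D = \<Sigma> \<and> deterministic_oca D \<and>
     oca_lang D = {w. \<exists>c. choice_run ch (q0, 0) w = Some c \<and> fst c \<in> F}"
proof -
  define J where "J = Q \<times> {..<M + P}"
  have "finite J" using fin by (simp add: J_def)
  then obtain g :: "'q \<times> nat \<Rightarrow> nat" where g: "inj_on g J"
    using finite_imp_inj_to_nat_seg by blast
  define red where "red n = (if n < M then n else M + (n - M) mod P)" for n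
  have red_less: "red n < M + P" for n using P(1) by (simp add: red_def)
  have red_id: "red n = n" if "n \<le> M" for n using that by (simp add: red_def)
  have red_ge: "M \<le> red n" if "M \<le> n" for n using that by (simp add: red_def)
  have red_eq: "red m = red n" if "M \<le> n" "m = n + c * P" for m n c
  proof -
    have "m - M = (n - M) + c * P" using that by simp
    then have "(m - M) mod P = (n - M) mod P" by simp
    then show ?thesis using that by (simp add: red_def)
  qed
  \<comment> \<open>The automaton's counter \<open>n - M\<close> is zero exactly for
    \<open>n \<le> M\<close>, where the state stores \<open>n\<close> itself. Truncated subtraction
    gives update 1 for an increment at \<open>M\<close> and 0 otherwise.\<close>
  define zeros where "zeros = {(g (q, j), True, a, int (nat (int j + d) - M), g (p, red (nat (int j + d)))) | q j a d p.
      q \<in> Q \<and> j \<le> M \<and> ch j q a = Some (d, p)}"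
  \<comment> \<open>The representative \<open>j + P\<close> is used instead of \<open>j\<close> so
    that a decrement stays at or above \<open>M\<close>, where \<open>red\<close> depends only on
    the residue.\<close>
  define nonzeros where "nonzeros = {(g (q, j), False, a, d, g (p, red (nat (int (j + P) + d)))) | q j a d p.
      q \<in> Q \<and> M \<le> j \<and> j < M + P \<and> ch (j + P) q a = Some (d, p)}"
  define D where "D = \<lparr>oca_states = g ` J, oca_alph = \<Sigma>, oca_delta = zeros \<union> nonzeros,
      oca_init = g (q0, red 0), oca_final = g ` {(q, j)\<in>J. q \<in> F}\<rparr>"
  have inJ: "(q, red n) \<in> J" if "q \<in> Q" for q n using that red_less by (simp add: J_def)
  have inJ': "(q, j) \<in> J" if "q \<in> Q" "j \<le> M" for q j using that P(1) by (simp add: J_def)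
  have inJ'': "(q, j) \<in> J" if "q \<in> Q" "j < M + P" for q j using that by (simp add: J_def)
  have geq: "g (q, j) = g (q', j') \<longleftrightarrow> q = q' \<and> j = j'" if "(q, j) \<in> J" "(q', j') \<in> J" for q j q' j'
    using g that by (auto simp: inj_on_def)
  have z01: "int (nat (int j + d) - M) \<in> {0, 1}" if "j \<le> M" "ch j q a = Some (d, p)" for j q a d p
    using ch[OF that(2)] that(1) by auto
  have wf: "wf_oca D"
    unfolding wf_oca_def
  proof (intro conjI)
    show "oca_delta D \<subseteq> oca_states D \<times> UNIV \<times> oca_alph D \<times> {-1, 0, 1} \<times> oca_states D"
    proof
      fix t assume "t \<in> oca_delta D"
      then consider "t \<in> zeros" | "t \<in> nonzeros" by (auto simp: D_def)
      then show "t \<in> oca_states D \<times> UNIV \<times> oca_alph D \<times> {-1, 0, 1} \<times> oca_states D"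
      proof cases
        case 1
        then obtain q j a d p where t: "t = (g (q, j), True, a, int (nat (int j + d) - M), g (p, red (nat (int j + d))))"
          and *: "q \<in> Q" "j \<le> M" "ch j q a = Some (d, p)" unfolding zeros_def by blast
        show ?thesis using z01[OF *(2,3)] ch[OF *(3)] inJ'[OF *(1,2)] inJ[of p] by (auto simp: t D_def)
      next
        case 2
        then obtain q j a d p where t: "t = (g (q, j), False, a, d, g (p, red (nat (int (j + P) + d))))"
          and *: "q \<in> Q" "j < M + P" "ch (j + P) q a = Some (d, p)" unfolding nonzeros_def by blast
        show ?thesis using ch[OF *(3)] inJ''[OF *(1,2)] inJ[of p] by (auto simp: t D_def)
      qed
    qed
    show "\<forall>q a d p. (q, True, a, d, p) \<in> oca_delta D \<longrightarrow> d \<in> {0, 1}"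
      using z01 by (fastforce simp: D_def zeros_def nonzeros_def)
    show "finite (oca_states D)" using \<open>finite J\<close> by (simp add: D_def)
  qed (use fin(2) inJ[OF q0] in \<open>auto simp: D_def\<close>)
  have det: "deterministic_oca D"
    unfolding deterministic_oca_def
  proof (intro allI impI)
    fix s z a d p d' p' assume *: "(s, z, a, d, p) \<in> oca_delta D \<and> (s, z, a, d', p') \<in> oca_delta D"
    show "d = d' \<and> p = p'"
    proof (cases z)
      case True
      then have "(s, z, a, d, p) \<in> zeros" and "(s, z, a, d', p') \<in> zeros"
        using * by (auto simp: D_def nonzeros_def)
      have "\<exists>q j e r. s = g (q, j) \<and> q \<in> Q \<and> j \<le> M \<and> ch j q a = Some (e, r) \<and>
          k = int (nat (int j + e) - M) \<and> t = g (r, red (nat (int j + e)))" if "(s, z, a, k, t) \<in> zeros" for k t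
        using that unfolding zeros_def by blast
      from this[OF \<open>(s, z, a, d, p) \<in> zeros\<close>] this[OF \<open>(s, z, a, d', p') \<in> zeros\<close>]
      show ?thesis using geq inJ' by fastforce
    next
      case False
      then have "(s, z, a, d, p) \<in> nonzeros" "(s, z, a, d', p') \<in> nonzeros"
        using * by (auto simp: D_def zeros_def)
      have "\<exists>q j r. s = g (q, j) \<and> q \<in> Q \<and> j < M + P \<and> ch (j + P) q a = Some (k, r) \<and>
          t = g (r, red (nat (int (j + P) + k)))" if "(s, z, a, k, t) \<in> nonzeros" for k t
        using that unfolding nonzeros_def by blast
      from this[OF \<open>(s, z, a, d, p) \<in> nonzeros\<close>] this[OF \<open>(s, z, a, d', p') \<in> nonzeros\<close>]
      show ?thesis using geq inJ'' by fastforce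
    qed
  qed
  \<comment> \<open>Its graph is the bisimulation between runs driven by \<open>ch\<close> and runs
    of \<open>D\<close>.\<close>
  define rep where "rep c = (g (fst c, red (snd c)), snd c - M)" for c
  have step: "oca_step D (rep (q, n)) a s \<longleftrightarrow> (\<exists>d p. ch n q a = Some (d, p) \<and> s = rep (p, nat (int n + d)))"
    if q: "q \<in> Q" for q n a s
  proof (cases "n \<le> M")
    case True
    have "(g (q, n), True, a, k, t) \<in> oca_delta D \<longleftrightarrow>
       (\<exists>d p. ch n q a = Some (d, p) \<and> k = int (nat (int n + d) - M) \<and> t = g (p, red (nat (int n + d))))" for k t
    proof -
      have eq: "g (q, n) = g (q', j) \<and> q' \<in> Q \<and> j \<le> M \<longleftrightarrow> q' = q \<and> j = n" for q' j
        using geq[OF inJ'[OF q True], of q' j] inJ'[of q' j] q True by auto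
      have "(g (q, n), True, a, k, t) \<in> oca_delta D \<longleftrightarrow> (\<exists>q' j d p. (g (q, n) = g (q', j) \<and> q' \<in> Q \<and> j \<le> M) \<and>
          ch j q' a = Some (d, p) \<and> k = int (nat (int j + d) - M) \<and> t = g (p, red (nat (int j + d))))"
        by (simp add: D_def zeros_def nonzeros_def) blast
      then show ?thesis unfolding eq by blast
    qed
    then show ?thesis using True unfolding oca_step_def rep_def
      by (cases s) (auto simp: red_id)
  next
    case False
    obtain c where c: "n + P = red n + P + c * P"
    proof
      show "n + P = red n + P + (n - M) div P * P"
        using False div_mult_mod_eq[of "n - M" P] by (simp add: red_def)
    qed
    have Mr: "M \<le> red n" using False red_ge by simp
    have "ch (red n + P) = ch n"
      using period_multiple[of M ch P, OF P(2) Mr, of c] P(2)[OF Mr] c by simp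
    then have chn: "ch (red n + P) q a = ch n q a" by simp
    have red': "red (nat (int (red n + P) + d)) = red (nat (int n + d))" if "d \<in> {-1, 0, 1}" for d
    proof -
      have "nat (int n + d) + P = nat (int (red n + P) + d) + c * P"
        using c that False P(1) Mr by auto
      moreover have "M \<le> nat (int (red n + P) + d)" "M \<le> nat (int n + d)" using that False Mr P(1) by auto
      ultimately show ?thesis using red_eq[of _ "nat (int n + d) + P" c] red_eq[of "nat (int n + d)" "nat (int n + d) + P" 1] by simp
    qed
    have "(g (q, red n), False, a, k, t) \<in> oca_delta D \<longleftrightarrow>
       (\<exists>p. ch n q a = Some (k, p) \<and> t = g (p, red (nat (int n + k))))" for k t
    proof -
      have "(g (q, red n), False, a, k, t) \<in> oca_delta D \<longleftrightarrow>
         (\<exists>p. ch (red n + P) q a = Some (k, p) \<and> t = g (p, red (nat (int (red n + P) + k))))"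
      proof -
        have eq: "g (q, red n) = g (q', j) \<and> q' \<in> Q \<and> M \<le> j \<and> j < M + P \<longleftrightarrow> q' = q \<and> j = red n" for q' j
          using geq[of q "red n" q' j] inJ[OF q, of n] inJ''[of q' j] q Mr red_less[of n] by auto
        have "(g (q, red n), False, a, k, t) \<in> oca_delta D \<longleftrightarrow>
          (\<exists>q' j p. (g (q, red n) = g (q', j) \<and> q' \<in> Q \<and> M \<le> j \<and> j < M + P) \<and>
            ch (j + P) q' a = Some (k, p) \<and> t = g (p, red (nat (int (j + P) + k))))"
          by (simp add: D_def zeros_def nonzeros_def) blast
        then show ?thesis unfolding eq by blast
      qed
      then show ?thesis using chn red' ch by metis
    qed
    note delta = this
    have cnt: "int (n - M) + k = int (nat (int n + k) - M)" "nat (int (n - M) + k) = nat (int n + k) - M"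
      if "k \<in> {-1, 0, 1}" for k using False that by auto
    show ?thesis
    proof
      assume "oca_step D (rep (q, n)) a s"
      then obtain k where k: "(g (q, red n), False, a, k, fst s) \<in> oca_delta D" "snd s = nat (int (n - M) + k)"
        using False unfolding oca_step_def rep_def by auto
      then obtain p where p: "ch n q a = Some (k, p)" "fst s = g (p, red (nat (int n + k)))" using delta by blast
      then have "s = rep (p, nat (int n + k))" using k(2) cnt ch[OF p(1)] by (simp add: rep_def prod_eq_iff)
      then show "\<exists>d p. ch n q a = Some (d, p) \<and> s = rep (p, nat (int n + d))" using p by blast
    next
      assume "\<exists>d p. ch n q a = Some (d, p) \<and> s = rep (p, nat (int n + d))"
      then obtain d p where p: "ch n q a = Some (d, p)" "s = rep (p, nat (int n + d))" by blast
      then have "(g (q, red n), False, a, d, fst s) \<in> oca_delta D" using delta by (auto simp: rep_def)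
      moreover have "snd s = nat (int (n - M) + d)" "0 \<le> int (n - M) + d"
        using p cnt[of d] ch[OF p(1)] by (auto simp: rep_def)
      ultimately show "oca_step D (rep (q, n)) a s"
        using False unfolding oca_step_def rep_def by auto
    qed
  qed
  have run: "oca_run D (rep c) w s \<longleftrightarrow> (\<exists>c'. choice_run ch c w = Some c' \<and> s = rep c')"
    if "fst c \<in> Q" for c w s
    using that
  proof (induction w arbitrary: c)
    case Nil
    then show ?case by (auto elim: oca_run.cases intro: oca_run.intros)
  next
    case (Cons a w)
    obtain q n where c: "c = (q, n)" by fastforce
    have "oca_run D (rep c) (a # w) s \<longleftrightarrow> (\<exists>s'. oca_step D (rep c) a s' \<and> oca_run D s' w s)"
      by (subst oca_run.simps) blast
    also have "\<dots> \<longleftrightarrow> (\<exists>d p. ch n q a = Some (d, p) \<and> oca_run D (rep (p, nat (int n + d))) w s)"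
      unfolding c using step[of q n a] Cons.prems c by (metis fst_conv)
    also have "\<dots> \<longleftrightarrow> (\<exists>d p. ch n q a = Some (d, p) \<and>
        (\<exists>c'. choice_run ch (p, nat (int n + d)) w = Some c' \<and> s = rep c'))"
      using Cons.IH ch by (metis fst_conv)
    also have "\<dots> \<longleftrightarrow> (\<exists>c'. choice_run ch c (a # w) = Some c' \<and> s = rep c')"
      by (auto simp: c split: option.splits)
    finally show ?case .
  qed
  have stay: "fst c' \<in> Q" if "choice_run ch c w = Some c'" "fst c \<in> Q" for c w c'
    using that
  proof (induction w arbitrary: c)
    case (Cons a w)
    then obtain d p where "ch (snd c) (fst c) a = Some (d, p)" "choice_run ch (p, nat (int (snd c) + d)) w = Some c'"
      by (auto split: option.splits)
    then show ?case using Cons.IH ch by (metis fst_conv)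
  qed simp
  have init: "(oca_init D, 0) = rep (q0, 0)" by (simp add: D_def rep_def)
  have final: "fst (rep c) \<in> oca_final D \<longleftrightarrow> fst c \<in> F" if "fst c \<in> Q" for c
    using geq inJ[OF that, of "snd c"] by (auto simp: D_def rep_def)
  have "oca_lang D = {w. \<exists>c. choice_run ch (q0, 0) w = Some c \<and> fst c \<in> F}"
  proof -
    have "(\<exists>s. oca_run D (rep (q0, 0)) w s \<and> fst s \<in> oca_final D) \<longleftrightarrow>
        (\<exists>c. choice_run ch (q0, 0) w = Some c \<and> fst c \<in> F)" for w
    proof -
      have "oca_run D (rep (q0, 0)) w s \<longleftrightarrow> (\<exists>c. choice_run ch (q0, 0) w = Some c \<and> s = rep c)" for s
        using run[of "(q0, 0)"] q0 by simp
      moreover have "fst (rep c) \<in> oca_final D \<longleftrightarrow> fst c \<in> F" if "choice_run ch (q0, 0) w = Some c" for c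
        using final stay[OF that] q0 by simp
      ultimately show ?thesis by metis
    qed
    then show ?thesis unfolding oca_lang_def init by simp
  qed
  then show ?thesis using wf det by (intro exI[of _ D]) (simp add: D_def)
qed

section \<open>Eve's play simulates all runs on the same word\<close>

lemma play_conf_snoc:
  "play_conf N \<sigma> (w @ [a]) = (case play_conf N \<sigma> w of None \<Rightarrow> None | Some c \<Rightarrow> apply_trans N c a (\<sigma> w a))"
  by (simp add: play_conf_def split: option.split)

lemma play_conf_snoc_step:
  assumes "play_conf N \<sigma> (w @ [a]) = Some c1"
  obtains c where "play_conf N \<sigma> w = Some c" "ocn_step N c a c1"
proof -
  obtain c where c: "play_conf N \<sigma> w = Some c" "apply_trans N c a (\<sigma> w a) = Some c1"
    using assms by (auto simp: play_conf_snoc split: option.splits)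
  obtain q b d p where t: "\<sigma> w a = (q, b, d, p)" by (metis prod_cases4)
  have "ocn_step N c a c1"
    using c(2) unfolding t apply_trans_def ocn_step_def by (auto split: if_splits intro!: exI[of _ d])
  then show thesis using that c(1) by blast
qed

text \<open>Being reached by the same word is itself a simulation. An alive successor makes the
  extended word a prefix of the language, so the strategy must offer a legal step.\<close>

lemma ocn_sim_play:
  assumes wf: "wf_ocn N" and win: "winning_strategy N \<sigma>"
    and run: "ocn_run N (ocn_init N, 0) w c" and play: "play_conf N \<sigma> w = Some c'"
  shows "ocn_sim N c c'"
proof -
  have "\<exists>w. ocn_run N (ocn_init N, 0) w c \<and> play_conf N \<sigma> w = Some c'" using run play by blast
  then show ?thesis
  proof (coinduction arbitrary: c c')
    case (ocn_sim c c')
    then obtain w where run: "ocn_run N (ocn_init N, 0) w c" and play: "play_conf N \<sigma> w = Some c'" by blast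
    have "fst c' \<in> ocn_final N" if "fst c \<in> ocn_final N"
    \<comment> \<open>The winning condition constrains nonempty words only; on the empty word both
      configurations are the initial one.\<close>
    proof (cases w rule: rev_cases)
      case Nil
      then show ?thesis using run play that by (simp add: ocn_run_Nil_iff play_conf_def)
    next
      case (snoc u a)
      have "w \<in> ocn_lang N" unfolding ocn_lang_def using run that by blast
      moreover have "a \<in> ocn_alph N"
      proof -
        obtain c0 where "ocn_step N c0 a c"
          using run unfolding snoc ocn_run_snoc by blast
        then show ?thesis using wf by (auto simp: ocn_step_def wf_ocn_def)
      qed
      ultimately show ?thesis
        using win play unfolding winning_strategy_def snoc by (metis append_Nil2 option.inject)
    qed
    moreover have "\<exists>c1'. ocn_step N c' a c1' \<and>
        (\<exists>w. ocn_run N (ocn_init N, 0) w c1 \<and> play_conf N \<sigma> w = Some c1')"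
      if step: "ocn_step N c a c1" and al: "alive N c1" for a c1
    proof -
      have run1: "ocn_run N (ocn_init N, 0) (w @ [a]) c1"
        using run step unfolding ocn_run_snoc by blast
      have "a \<in> ocn_alph N" using step wf by (auto simp: ocn_step_def wf_ocn_def)
      moreover have "\<exists>v. (w @ [a]) @ v \<in> ocn_lang N"
        using al run1 ocn_run_append unfolding alive_def ocn_lang_def by blast
      ultimately obtain c1' where p1: "play_conf N \<sigma> (w @ [a]) = Some c1'"
        using win unfolding winning_strategy_def by blast
      then have "ocn_step N c' a c1'" using play_conf_snoc_step[OF p1] play by auto
      then show ?thesis using run1 p1 by blast
    qed
    ultimately show ?case by (intro conjI allI impI; simp) metis
  qed
qed

section \<open>Positional choice of a dominating transition\<close>

definition dominating :: "('q, 'a) ocn \<Rightarrow> nat \<Rightarrow> 'q \<Rightarrow> 'a \<Rightarrow> int \<times> 'q \<Rightarrow> bool" where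
  "dominating N n q a t \<longleftrightarrow> (q, a, t) \<in> ocn_delta N \<and> 0 \<le> int n + fst t \<and>
     (\<forall>d p. (q, a, d, p) \<in> ocn_delta N \<longrightarrow> 0 \<le> int n + d \<longrightarrow>
       ocn_sim N (p, nat (int n + d)) (snd t, nat (int n + fst t)))"

text \<open>The choice depends on \<open>n\<close> only through the predicate
  \<open>dominating N n q a\<close>, so periodicity of the predicate passes to the chosen
  transition.\<close>

definition pick :: "('q, 'a) ocn \<Rightarrow> nat \<Rightarrow> 'q \<Rightarrow> 'a \<Rightarrow> (int \<times> 'q) option" where
  "pick N n q a = (if \<exists>t. dominating N n q a t then Some (SOME t. dominating N n q a t) else None)"

lemma pick_dominating:
  assumes "pick N n q a = Some t"
  shows "dominating N n q a t"
proof -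
  have "\<exists>t. dominating N n q a t" "t = (SOME t. dominating N n q a t)"
    using assms unfolding pick_def by (simp_all split: if_split_asm del: split_paired_Ex) blast
  then show ?thesis by (simp only: someI_ex)
qed

text \<open>Comparing two sibling targets is a simulation question at counter
  \<open>m = n + d'\<close> with offset \<open>d - d'\<close>. Only finitely many such questions
  arise, and they share a period.\<close>

lemma pick_periodic:
  assumes wf: "wf_ocn N"
  shows "\<exists>M P. 0 < P \<and> (\<forall>n\<ge>M. pick N (n + P) = pick N n)"
proof -
  let ?I = "ocn_states N \<times> ocn_states N \<times> {-1, 0, 1} \<times> {-1, 0, 1::int}"
  define f where "f = (\<lambda>(p', p, d', d) n. ocn_sim N (p', nat (int n + d')) (p, nat (int n + d)))"
  have "\<exists>M P. 0 < P \<and> (\<forall>n\<ge>M. f i (n + P) = f i n)" if "i \<in> ?I" for i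
  proof -
    obtain p' p d' d where i: "i = (p', p, d', d)" by (metis prod_cases4)
    have d': "d' \<in> {-1, 0, 1}" and Q: "p' \<in> ocn_states N" "p \<in> ocn_states N" using that i by auto
    obtain M P where P: "0 < P" and *: "\<And>m. M \<le> m \<Longrightarrow>
        ocn_sim N (p', m + P) (p, nat (int (m + P) + (d - d'))) \<longleftrightarrow> ocn_sim N (p', m) (p, nat (int m + (d - d')))"
      using ocn_sim_diagonal_periodic[OF wf Q, of "d - d'"] by blast
    \<comment> \<open>The additional 1 in the bound leaves room for \<open>d' = -1\<close>.\<close>
    have "f i (n + P) = f i n" if "Suc M \<le> n" for n
    proof -
      define m where "m = nat (int n + d')"
      have "M \<le> m" "nat (int (n + P) + d') = m + P" "nat (int n + d') = m"
        "int (n + P) + d = int (m + P) + (d - d')" "int n + d = int m + (d - d')"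
        using d' that by (auto simp: m_def)
      then show ?thesis using *[OF \<open>M \<le> m\<close>] unfolding f_def i prod.case by presburger
    qed
    then show ?thesis using P by blast
  qed
  moreover have "finite ?I" using wf by (simp add: wf_ocn_def)
  ultimately have "\<exists>M P. 0 < P \<and> (\<forall>i\<in>?I. \<forall>n\<ge>M. f i (n + P) = f i n)"
    by (intro common_period)
  then obtain M P where P: "0 < P" "\<forall>i\<in>?I. \<forall>n\<ge>M. f i (n + P) = f i n"
    by (elim exE conjE)
  have delta: "q \<in> ocn_states N" "d \<in> {-1, 0, 1}" "p \<in> ocn_states N" if "(q, a, d, p) \<in> ocn_delta N" for q a d p
    using wf that by (auto simp: wf_ocn_def)
  have "dominating N (n + P) q a t \<longleftrightarrow> dominating N n q a t" if "Suc M \<le> n" for n q a t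
  proof -
    obtain d p where t: "t = (d, p)" by fastforce
    have sim: "ocn_sim N (p', nat (int (n + P) + d')) (p, nat (int (n + P) + d)) \<longleftrightarrow>
        ocn_sim N (p', nat (int n + d')) (p, nat (int n + d))"
      if "(q, a, d, p) \<in> ocn_delta N" "(q, a, d', p') \<in> ocn_delta N" for d' p'
    proof -
      have "(p', p, d', d) \<in> ?I" using delta[OF that(1)] delta[OF that(2)] by blast
      moreover have "M \<le> n" using \<open>Suc M \<le> n\<close> by simp
      ultimately have "f (p', p, d', d) (n + P) = f (p', p, d', d) n" by (rule P(2)[rule_format])
      then show ?thesis by (simp only: f_def prod.case)
    qed
    have pos: "0 \<le> int (n + P) + d' \<longleftrightarrow> 0 \<le> int n + d'" if "(q, a, d', p') \<in> ocn_delta N" for d' p'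
      using delta(2)[OF that] \<open>Suc M \<le> n\<close> by auto
    show ?thesis unfolding dominating_def t fst_conv snd_conv using sim pos by blast
  qed
  then have "dominating N (n + P) = dominating N n" if "Suc M \<le> n" for n
    using that by (intro ext)
  then have "pick N (n + P) = pick N n" if "Suc M \<le> n" for n
    unfolding pick_def[abs_def] by (simp only: that)
  then show ?thesis using P(1) by blast
qed

lemma choice_run_ocn_run:
  "choice_run (pick N) c w = Some c' \<Longrightarrow> ocn_run N c w c'"
proof (induction w arbitrary: c)
  case (Cons a w)
  then obtain d p where t: "pick N (snd c) (fst c) a = Some (d, p)"
    and r: "choice_run (pick N) (p, nat (int (snd c) + d)) w = Some c'"
    by (auto split: option.splits)
  have "ocn_step N c a (p, nat (int (snd c) + d))"
    using pick_dominating[OF t] by (auto simp: dominating_def ocn_step_def)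
  then show ?case using Cons.IH[OF r] by (rule ocn_run_cons)
qed (simp add: ocn_run_Nil_iff)

text \<open>The invariant is that the positional play simulates the play of the winning strategy.
  The latter simulates every configuration reached by the same word, hence all siblings of the
  positional successor, so a dominating transition exists.\<close>

lemma choice_run_follows:
  assumes wf: "wf_ocn N" and win: "winning_strategy N \<sigma>" and L: "u @ v \<in> ocn_lang N"
  shows "\<exists>c c'. play_conf N \<sigma> u = Some c \<and> choice_run (pick N) (ocn_init N, 0) u = Some c' \<and> ocn_sim N c c'"
  using L
proof (induction u arbitrary: v rule: rev_induct)
  case Nil
  show ?case by (simp add: play_conf_def ocn_sim_mono)
next
  case (snoc a u)
  let ?i = "(ocn_init N, 0)"
  obtain c c' where IH: "play_conf N \<sigma> u = Some c" "choice_run (pick N) ?i u = Some c'" "ocn_sim N c c'"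
    using snoc.IH[of "a # v"] snoc.prems by auto
  obtain f where f: "ocn_run N ?i ((u @ [a]) @ v) f" "fst f \<in> ocn_final N"
    using snoc.prems unfolding ocn_lang_def by auto
  obtain e where e: "ocn_run N ?i (u @ [a]) e" "ocn_run N e v f"
    using f(1) unfolding ocn_run_append[of N ?i "u @ [a]"] by blast
  have ale: "alive N e" using e(2) f(2) alive_def by blast
  obtain e0 where "ocn_step N e0 a e"
    using e(1) unfolding ocn_run_snoc by blast
  then have "a \<in> ocn_alph N" using wf by (auto simp: ocn_step_def wf_ocn_def)
  then obtain c1 where c1: "play_conf N \<sigma> (u @ [a]) = Some c1"
    using win snoc.prems unfolding winning_strategy_def by blast
  then have step: "ocn_step N c a c1" using play_conf_snoc_step[OF c1] IH(1) by auto
  have al1: "alive N c1" using ocn_sim_alive[OF ocn_sim_play[OF wf win e(1) c1] ale] .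
  obtain c1' where c1': "ocn_step N c' a c1'" "ocn_sim N c1 c1'"
    using ocn_simD(2)[OF IH(3) step al1] by blast
  obtain q n where c': "c' = (q, n)" by fastforce
  \<comment> \<open>The positional play is itself a run, so each sibling \<open>e1\<close> is
    reached by the extended word and is simulated by \<open>c1\<close>, which \<open>c1'\<close>
    simulates in turn.\<close>
  have sib: "ocn_sim N e1 c1'" if "ocn_step N c' a e1" for e1
  proof -
    have "ocn_run N ?i (u @ [a]) e1"
      using choice_run_ocn_run[OF IH(2)] that unfolding ocn_run_snoc by blast
    from ocn_sim_trans[OF ocn_sim_play[OF wf win this c1] c1'(2)] show ?thesis .
  qed
  have nstep: "ocn_step N c' a (p, nat (int n + d))" if "(q, a, d, p) \<in> ocn_delta N" "0 \<le> int n + d" for d p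
    using that by (auto simp: ocn_step_def c')
  obtain d p where dp: "(q, a, d, p) \<in> ocn_delta N" "0 \<le> int n + d" "c1' = (p, nat (int n + d))"
    using c1'(1) by (cases c1') (auto simp: ocn_step_def c')
  have "dominating N n q a (d, p)"
    using dp sib[OF nstep] by (simp add: dominating_def)
  then have "\<exists>t. dominating N n q a t" by (rule exI)
  then obtain t where t: "pick N n q a = Some t" unfolding pick_def by simp
  obtain d' p' where tdp: "t = (d', p')" by fastforce
  have "ocn_sim N c1' (p', nat (int n + d'))"
    using pick_dominating[OF t] dp unfolding tdp dominating_def by simp
  then have "ocn_sim N c1 (p', nat (int n + d'))" using ocn_sim_trans[OF c1'(2)] by blast
  moreover have "choice_run (pick N) ?i (u @ [a]) = Some (p', nat (int n + d'))"
    using IH(2) t by (simp add: choice_run_append c' tdp)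
  ultimately show ?case using c1 by blast
qed

lemma choice_run_lang:
  assumes wf: "wf_ocn N" and win: "winning_strategy N \<sigma>"
  shows "ocn_lang N = {w. \<exists>c. choice_run (pick N) (ocn_init N, 0) w = Some c \<and> fst c \<in> ocn_final N}"
proof (intro set_eqI iffI)
  fix w assume w: "w \<in> ocn_lang N"
  then obtain e where e: "ocn_run N (ocn_init N, 0) w e" "fst e \<in> ocn_final N" unfolding ocn_lang_def by blast
  obtain c c' where c: "play_conf N \<sigma> w = Some c" "choice_run (pick N) (ocn_init N, 0) w = Some c'" "ocn_sim N c c'"
    using choice_run_follows[OF wf win, of w "[]"] w by auto
  have "ocn_sim N e c'" using ocn_sim_trans[OF ocn_sim_play[OF wf win e(1) c(1)] c(3)] .
  then have "fst c' \<in> ocn_final N" using ocn_simD(1)[OF _ e(2)] by blast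
  then show "w \<in> {w. \<exists>c. choice_run (pick N) (ocn_init N, 0) w = Some c \<and> fst c \<in> ocn_final N}"
    using c(2) by blast
next
  fix w assume "w \<in> {w. \<exists>c. choice_run (pick N) (ocn_init N, 0) w = Some c \<and> fst c \<in> ocn_final N}"
  then show "w \<in> ocn_lang N" unfolding ocn_lang_def using choice_run_ocn_run by blast
qed

theorem theorem3:
  fixes N :: "('q, 'a) ocn"
  assumes "wf_ocn N" and "history_deterministic N"
  shows "\<exists>D :: (nat, 'a) oca. wf_oca D \<and> oca_alph D = ocn_alph N \<and> deterministic_oca D \<and>
           oca_lang D = ocn_lang N"
proof -
  obtain \<sigma> where \<sigma>: "winning_strategy N \<sigma>" using assms(2) unfolding history_deterministic_def by blast
  obtain M P where P: "0 < P" "\<And>n. M \<le> n \<Longrightarrow> pick N (n + P) = pick N n"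
    using pick_periodic[OF assms(1)] by blast
  have "a \<in> ocn_alph N \<and> d \<in> {-1, 0, 1} \<and> p \<in> ocn_states N \<and> 0 \<le> int n + d"
    if "pick N n q a = Some (d, p)" for n q a d p
    using pick_dominating[OF that] assms(1) by (auto simp: dominating_def wf_ocn_def)
  then show ?thesis
    unfolding choice_run_lang[OF assms(1) \<sigma>]
    using assms(1) P by (intro periodic_choice_oca[where M = M and P = P]) (auto simp: wf_ocn_def)
qed

end
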